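(* For every integer $n\ge1$, the fifth factorial moment of the area statistic on parking functions of length $n$ is $$-\frac{105845}{110592}n^7-\frac{2170159}{290304}n^6-\frac{99955651}{3870720}n^5-\frac{30773609}{725760}n^4-\frac{94846903}{11612160}n^3+\frac{24676991}{483840}n^2+\frac{392763901}{11612160}n$$ $$+\left(\frac{565}{2048}n^6+\frac{1005}{128}n^5+\frac{9832585}{165888}n^4+\frac{1111349}{5184}n^3+\frac{826358527}{1935360}n^2+\frac{159943787}{362880}n+\frac{1024580441}{5806080}\right)E_1(n),$$ and asymptotically, as $n\to\infty$, it equals $\frac{565}{8192}\sqrt{2\pi}\cdot n^{15/2}+O(n^7)$.
   Context: A parking function of length $n$ is a vector of positive integers $(p_1,\dots,p_n)$, $1\le p_i\le n$, whose non-decreasing rearrangement satisfies $p_{(i)}\le i$ for $1\le i\le n$; there are $(n+1)^{n-1}$ of them. The area statistic is $\mathrm{Area}(p)=\frac{n(n+1)}{2}-\sum_{i=1}^n p_i$. Choose $p$ uniformly at random among parking functions of length $n$; the $k$-th factorial moment of the area is $E[A(A-1)\cdots(A-k+1)]$ with $A=\mathrm{Area}(p)$, and $E_1(n)=E[A]$ is its expectation. *)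

theory Defs
  imports "HOL-Probability.Probability" "HOL-Library.Landau_Symbols"
begin

text \<open>
  The vector $(p_1, \dots, p_n)$ is a list of length $n$. List indices start at $0$, so $p_{(i)}$,
  the $i$-th entry of the non-decreasing rearrangement, is \<open>sort p ! (i - 1)\<close>.
\<close>

definition parking_functions :: "nat \<Rightarrow> nat list set" where
  "parking_functions n =
     {p. length p = n \<and> set p \<subseteq> {1..n} \<and> (\<forall>i\<in>{1..n}. sort p ! (i - 1) \<le> i)}"

definition area :: "nat list \<Rightarrow> real" where
  "area p = real (length p) * (real (length p) + 1) / 2 - real (sum_list p)"

definition random_parking_function :: "nat \<Rightarrow> nat list pmf" where
  "random_parking_function n = pmf_of_set (parking_functions n)"

definition expected_area :: "nat \<Rightarrow> real" where
  "expected_area n = measure_pmf.expectation (random_parking_function n) area"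

definition area_factorial_moment :: "nat \<Rightarrow> nat \<Rightarrow> real" where
  "area_factorial_moment k n =
     measure_pmf.expectation (random_parking_function n) (\<lambda>p. \<Prod>j<k. area p - real j)"

text \<open>
  \<^const>\<open>pmf_of_set\<close> is the uniform distribution only on a finite non-empty set.
\<close>

lemma finite_parking_functions: "finite (parking_functions n)"
proof (rule finite_subset)
  show "parking_functions n \<subseteq> {p. set p \<subseteq> {1..n} \<and> length p = n}"
    by (auto simp: parking_functions_def)
  show "finite {p. set p \<subseteq> {1..n} \<and> length p = n}"
    by (rule finite_lists_length_eq) simp
qed

lemma parking_functions_nonempty: "parking_functions n \<noteq> {}"
proof -
  have "sort (replicate n (1::nat)) = replicate n 1"
    by (intro sorted_sort_id) (simp add: sorted_replicate)
  then have "replicate n 1 \<in> parking_functions n"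
    by (auto simp: parking_functions_def)
  then show ?thesis
    by blast
qed

end

theory Submission
  imports Defs "HOL-Real_Asymp.Real_Asymp"
begin

text \<open>
  Remove the first car from a parking function of length \<open>n + 1\<close>. The rest falls apart at the first
  value at which it is one entry short, into a parking function of length \<open>k\<close> and a shifted parking
  function of length \<open>n - k\<close>, shuffled arbitrarily, while the removed entry ranges freely over
  \<open>{1..k + 1}\<close>. The area is additive up to a term that is uniform on \<open>{0..k}\<close>, so Vandermonde's
  identity gives a quadratic recurrence for the binomial moments
  \<open>\<Sum>\<^sub>p (area p gchoose k)\<close> (\<open>binomial_moment_Suc\<close>).

  For the generating functions \<open>G\<^sub>k = \<Sum>\<^sub>n binomial_moment k n * z ^ (n + 1) / n!\<close> and the
  Euler operator \<open>\<theta> = z d/dz\<close> the recurrence reads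
  \<open>\<theta> G\<^sub>k - G\<^sub>k = \<Sum> (\<theta> choose (a + 1)) G\<^sub>b * G\<^sub>c\<close>, summed over \<open>a + b + c = k\<close>.
  The series \<open>T = G\<^sub>0\<close> is the tree function, and \<open>Y = \<theta> T = T / (1 - T)\<close> satisfies
  \<open>\<theta> Y = Y * (1 + Y)\<^sup>2\<close>. Hence \<open>\<theta>\<close> preserves the space \<open>T * \<real>[Y]\<close>, and on it the equation is
  one between polynomials in \<open>Y\<close>. Up to \<open>k = 5\<close> its solutions are polynomials, \<open>G\<^sub>k = T * f\<^sub>k(Y)\<close>, and
  as the equation determines \<open>G\<^sub>k\<close> from its predecessors (\<open>moment_fps_eqI\<close>) it is enough to
  exhibit \<open>f\<^sub>1, \<dots>, f\<^sub>5\<close> and to multiply out.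

  The operator \<open>\<theta> - 1\<close> multiplies the coefficient of \<open>z ^ (n + 1)\<close> by \<open>n\<close>. A relation between the
  fifth, the first and the zeroth moment with coefficients polynomial in \<open>n\<close> is therefore the same as
  a relation \<open>120 * G\<^sub>5 = p(\<theta> - 1) T + r(\<theta> - 1) G\<^sub>1\<close>, which is again an identity of polynomials in \<open>Y\<close>
  (\<open>moment_poly_5\<close>).

  For the growth, \<open>G\<^sub>1 = T * Y\<^sup>2 / 2\<close>, and the coefficients of \<open>T ^ j * (1 + Y)\<close> are
  \<open>N ^ (N - j) / (N - j)!\<close>; so \<open>expected_area n\<close> is an elementary expression in Ramanujan's
  \<open>Q(N) = \<Sum>\<^sub>k N! / ((N - k)! * N ^ k)\<close> at \<open>N = n + 1\<close>. The series of \<open>exp N\<close>, multiplied by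
  \<open>N! / N ^ N\<close>, splits at its \<open>N\<close>-th term into \<open>Q(N)\<close> and a tail that differs from \<open>Q(N)\<close> by at most \<open>4\<close>.
  Stirling's formula thus gives \<open>2 * Q(N) = sqrt (2 * pi * N) + O(1)\<close> and
  \<open>expected_area n = sqrt (2 * pi) / 4 * n powr (3 / 2) + O(n)\<close>, and the closed form transfers this to
  the fifth moment.
\<close>

unbundle no vec_syntax
unbundle fps_syntax

section \<open>Decomposing a parking function at its first deficit\<close>

definition count_le :: "nat \<Rightarrow> nat list \<Rightarrow> nat" where
  "count_le v p = length (filter (\<lambda>x. x \<le> v) p)"

lemma sorted_nth_le_iff_count:
  assumes "sorted s" "i < length s"
  shows "s ! i \<le> v \<longleftrightarrow> i < count_le v s"
  using assms
proof (induction s arbitrary: i)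
  case (Cons x s)
  show ?case
  proof (cases "x \<le> v")
    case True
    then show ?thesis
      using Cons by (cases i) (auto simp: count_le_def)
  next
    case False
    then have "\<forall>y\<in>set (x # s). \<not> y \<le> v"
      using Cons.prems by auto
    moreover from this have "count_le v (x # s) = 0"
      unfolding count_le_def by (metis filter_False list.size(3))
    ultimately show ?thesis
      using Cons.prems(2) by (metis nth_mem not_less0)
  qed
qed simp

lemma count_le_sort: "count_le v (sort p) = count_le v p"
  unfolding count_le_def by (metis mset_filter mset_sort size_mset)

lemma count_le_mono: "v \<le> w \<Longrightarrow> count_le v p \<le> count_le w p"
  unfolding count_le_def by (induction p) auto

lemma count_le_length: "count_le v p \<le> length p"
  unfolding count_le_def by simp

lemma count_le_eq_length: "count_le v p = length p \<longleftrightarrow> (\<forall>x\<in>set p. x \<le> v)"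
  unfolding count_le_def by (metis (no_types, lifting) filter_id_conv filter_True length_filter_less less_irrefl)

text \<open>
  Counting entries replaces the sorted rearrangement by a condition that is additive under shuffling.
  The upper bound on the entries is the case \<open>v = n\<close> of the counting condition.
\<close>

lemma parking_function_iff:
  "p \<in> parking_functions n \<longleftrightarrow>
     length p = n \<and> 0 \<notin> set p \<and> (\<forall>v\<le>n. v \<le> count_le v p)"
proof (cases "length p = n")
  case True
  have "(\<forall>i\<in>{1..n}. sort p ! (i - 1) \<le> i) \<longleftrightarrow> (\<forall>v\<le>n. v \<le> count_le v p)"
  proof (intro iffI allI ballI impI)
    fix v assume *: "\<forall>i\<in>{1..n}. sort p ! (i - 1) \<le> i" and "v \<le> n"
    show "v \<le> count_le v p"
    proof (cases "v = 0")
      case False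
      then have "sort p ! (v - 1) \<le> v" using * \<open>v \<le> n\<close> by auto
      then have "v - 1 < count_le v (sort p)"
        using sorted_nth_le_iff_count[of "sort p" "v - 1" v] False \<open>v \<le> n\<close> True by simp
      then show ?thesis by (simp add: count_le_sort)
    qed simp
  next
    fix i assume *: "\<forall>v\<le>n. v \<le> count_le v p" and "i \<in> {1..n}"
    have "i \<le> count_le i p"
      using * \<open>i \<in> {1..n}\<close> by simp
    then have "i - 1 < count_le i (sort p)"
      using \<open>i \<in> {1..n}\<close> unfolding count_le_sort by auto
    then show "sort p ! (i - 1) \<le> i"
      using sorted_nth_le_iff_count[of "sort p" "i - 1" i] \<open>i \<in> {1..n}\<close> True by auto
  qed
  moreover have "set p \<subseteq> {1..n} \<longleftrightarrow> 0 \<notin> set p" if "\<forall>v\<le>n. v \<le> count_le v p"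
  proof -
    have "count_le n p = length p"
      using that True count_le_length[of n p] by (simp add: le_antisym)
    then have "\<forall>x\<in>set p. x \<le> n" by (simp add: count_le_eq_length)
    then show ?thesis by (auto simp: Suc_le_eq intro: gr0I)
  qed
  ultimately show ?thesis
    using True unfolding parking_functions_def by auto
qed (auto simp: parking_functions_def)

lemma count_le_parking:
  assumes "p \<in> parking_functions n" "n \<le> v"
  shows "count_le v p = n"
  using assms count_le_mono[of n v p] count_le_length[of v p]
  by (auto simp: parking_function_iff intro!: le_antisym dest!: spec[of _ n])

lemma filter_shuffle_shifted:
  fixes c :: nat
  assumes l: "\<forall>x\<in>set l. x \<le> c" and r: "0 \<notin> set r"
    and s: "s \<in> shuffles l (map ((+) c) r)"
  shows "filter (\<lambda>x. x \<le> c) s = l"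
    and "filter (\<lambda>x. \<not> x \<le> c) s = map ((+) c) r"
proof -
  have f: "filter P s \<in> shuffles (filter P l) (filter P (map ((+) c) r))" for P
    using s filter_shuffles[of P l "map ((+) c) r"] by blast
  have "0 < x" if "x \<in> set r" for x
    using r that by (metis gr0I)
  then have "\<forall>x\<in>set (map ((+) c) r). \<not> x \<le> c"
    by fastforce
  then show "filter (\<lambda>x. x \<le> c) s = l"
    and "filter (\<lambda>x. \<not> x \<le> c) s = map ((+) c) r"
    using f[of "\<lambda>x. x \<le> c"] f[of "\<lambda>x. \<not> x \<le> c"] l by (simp_all add: filter_id_conv)
qed

lemma count_le_map_add:
  "count_le v (map ((+) c) r) = (if c \<le> v then count_le (v - c) r else 0)"
  unfolding count_le_def by (induction r) auto

lemma count_le_shuffles: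
  assumes "s \<in> shuffles l r"
  shows "count_le v s = count_le v l + count_le v r"
proof -
  have "filter (\<lambda>x. x \<le> v) s \<in> shuffles (filter (\<lambda>x. x \<le> v) l) (filter (\<lambda>x. x \<le> v) r)"
    using assms filter_shuffles by blast
  then show ?thesis
    unfolding count_le_def by (rule length_shuffles)
qed

text \<open>
  The value \<open>k + 1\<close> is the first one at which \<open>s\<close> has too few entries to be a parking function; when
  the cars of \<open>s\<close> park on an unbounded street, it is the first spot left empty. No entry of \<open>s\<close> equals
  \<open>k + 1\<close>, because \<open>count_le k s\<close> is already \<open>k\<close>.
\<close>

definition splits_at :: "nat \<Rightarrow> nat list \<Rightarrow> bool" where
  "splits_at k s \<longleftrightarrow> (\<forall>v\<le>k. v \<le> count_le v s) \<and> count_le (Suc k) s = k"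

lemma splits_at_unique:
  assumes "splits_at j s" "splits_at k s"
  shows "j = k"
  using assms unfolding splits_at_def
  by (metis Suc_leI linorder_neqE_nat not_less_eq_eq order_refl)

lemma splits_at_exists: "\<exists>k. splits_at k s"
proof -
  define v where "v = (LEAST v. count_le v s < v)"
  have "count_le (Suc (length s)) s < Suc (length s)"
    using count_le_length le_imp_less_Suc by blast
  then have v: "count_le v s < v"
    unfolding v_def by (rule LeastI)
  then obtain k where k: "v = Suc k"
    by (cases v) auto
  have below: "u \<le> count_le u s" if "u \<le> k" for u
    using not_less_Least[of u "\<lambda>v. count_le v s < v"] that k unfolding v_def by auto
  moreover have "count_le (Suc k) s = k"
    using v k below[of k] count_le_mono[of k "Suc k" s] by simp
  ultimately show ?thesis
    unfolding splits_at_def by auto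
qed

text \<open>
  The entries of the shifted list exceed \<open>k + 1\<close>, so they leave the deficit of \<open>l\<close> at \<open>k + 1\<close> untouched;
  an additional entry \<open>c \<le> k + 1\<close> fills the spot \<open>k + 1\<close>, and from there on the counts of \<open>r\<close> suffice.
\<close>

lemma shuffle_splits_at:
  assumes l: "l \<in> parking_functions k" and r: "r \<in> parking_functions m"
    and s: "s \<in> shuffles l (map ((+) (Suc k)) r)"
  shows "splits_at k s"
    and "c \<in> {1..Suc k} \<Longrightarrow> c # s \<in> parking_functions (Suc (k + m))"
proof -
  have count: "count_le v s = count_le v l + (if Suc k \<le> v then count_le (v - Suc k) r else 0)" for v
    using count_le_shuffles[OF s] count_le_map_add by simp
  have "count_le 0 r = 0"
    using r unfolding count_le_def parking_function_iff by (metis (mono_tags) filter_False le_zero_eq list.size(3))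
  then show "splits_at k s"
    using l count_le_parking[OF l, of "Suc k"] unfolding splits_at_def
    by (auto simp: count parking_function_iff)
  assume c: "c \<in> {1..Suc k}"
  have "v \<le> count_le v (c # s)" if "v \<le> Suc (k + m)" for v
  proof (cases "v \<le> k")
    case True
    then have "v \<le> count_le v s"
      using l by (simp add: count parking_function_iff)
    then show ?thesis
      by (simp add: count_le_def)
  next
    case False
    have "v - Suc k \<le> count_le (v - Suc k) r"
      using r that by (simp add: parking_function_iff)
    moreover have "count_le v l = k"
      using count_le_parking[OF l] False by simp
    moreover have "count_le v (c # s) = Suc (count_le v s)"
      using c False by (simp add: count_le_def)
    ultimately show ?thesis
      using False by (simp add: count)
  qed
  moreover have "length s = k + m"
    using length_shuffles[OF s] l r by (simp add: parking_function_iff)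
  moreover have "0 \<notin> set (c # s)"
    using set_shuffles[OF s] l c by (auto simp: parking_function_iff)
  ultimately show "c # s \<in> parking_functions (Suc (k + m))"
    by (simp add: parking_function_iff)
qed

text \<open>
  The deficit of \<open>s\<close> at \<open>k + 1\<close> can only be repaired by \<open>c\<close>, which forces \<open>c \<le> k + 1\<close>. The entries
  below and above \<open>k + 1\<close> then inherit the counting conditions.
\<close>

lemma parking_function_split:
  assumes p: "c # s \<in> parking_functions (Suc n)" and k: "splits_at k s"
  obtains l r where "l \<in> parking_functions k" "r \<in> parking_functions (n - k)"
    "s \<in> shuffles l (map ((+) (Suc k)) r)" "c \<in> {1..Suc k}" "k \<le> n"
proof -
  have len: "length s = n" and pos: "0 \<notin> set s" "c \<ge> 1"
    using p by (auto simp: parking_function_iff Suc_le_eq intro: gr0I)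
  have kn: "k \<le> n"
    using k count_le_length[of "Suc k" s] len by (simp add: splits_at_def)
  have "Suc k \<le> count_le (Suc k) (c # s)"
    using p kn by (simp add: parking_function_iff)
  then have c: "c \<le> Suc k"
    using k by (auto simp: count_le_def splits_at_def split: if_splits)
  define l where "l = filter (\<lambda>x. x \<le> Suc k) s"
  define r where "r = map (\<lambda>x. x - Suc k) (filter (\<lambda>x. \<not> x \<le> Suc k) s)"
  have shift: "map ((+) (Suc k)) r = filter (\<lambda>x. \<not> x \<le> Suc k) s"
    unfolding r_def map_map by (rule map_idI) auto
  have s: "s \<in> shuffles l (map ((+) (Suc k)) r)"
    unfolding l_def shift by (rule partition_in_shuffles)
  have lenl: "length l = k"
    using k unfolding l_def splits_at_def count_le_def by simp
  have cl: "count_le v l = count_le (min v (Suc k)) s" for v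
    unfolding l_def count_le_def by (auto intro!: arg_cong[where f = length] filter_cong)
  have l: "l \<in> parking_functions k"
    using k pos lenl by (auto simp: parking_function_iff cl splits_at_def min_def) (auto simp: l_def)
  have lenr: "length r = n - k"
    using length_shuffles[OF s] len lenl by simp
  have "v \<le> count_le v r" if v: "v \<le> n - k" for v
  proof -
    have "Suc k + v \<le> Suc (count_le (Suc k + v) s)"
      using p v c kn by (auto simp: parking_function_iff count_le_def dest!: spec[of _ "Suc k + v"])
    also have "count_le (Suc k + v) s = k + count_le v r"
      using count_le_shuffles[OF s, of "Suc k + v"] count_le_parking[OF l, of "Suc k + v"]
      by (simp add: count_le_map_add)
    finally show ?thesis by simp
  qed
  then have "r \<in> parking_functions (n - k)"
    using lenr by (auto simp: parking_function_iff r_def)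
  then show thesis
    using that l s c pos kn by auto
qed

text \<open>
  The splitting point of the tail is unique, and filtering recovers the two shuffled lists; hence
  every parking function of length \<open>n + 1\<close> arises exactly once.
\<close>

lemma bij_betw_parking_split:
  "bij_betw (\<lambda>(k, (l, r), c, s). c # s)
     (SIGMA k:{..n}. SIGMA lr:parking_functions k \<times> parking_functions (n - k).
        {1..Suc k} \<times> shuffles (fst lr) (map ((+) (Suc k)) (snd lr)))
     (parking_functions (Suc n))" (is "bij_betw ?f ?I _")
  unfolding bij_betw_def
proof (intro conjI inj_onI equalityI subsetI)
  fix x y assume x: "x \<in> ?I" and y: "y \<in> ?I" and eq: "?f x = ?f y"
  obtain k l r c s where x_eq: "x = (k, (l, r), c, s)" by (metis prod.exhaust)
  obtain k' l' r' c' s' where y_eq: "y = (k', (l', r'), c', s')" by (metis prod.exhaust)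
  have l: "l \<in> parking_functions k" and r: "r \<in> parking_functions (n - k)"
    and s: "s \<in> shuffles l (map ((+) (Suc k)) r)"
    using x by (auto simp: x_eq)
  have l': "l' \<in> parking_functions k'" and r': "r' \<in> parking_functions (n - k')"
    and s': "s' \<in> shuffles l' (map ((+) (Suc k')) r')"
    using y by (auto simp: y_eq)
  have [simp]: "c' = c" "s' = s"
    using eq by (auto simp: x_eq y_eq)
  have [simp]: "k' = k"
    using splits_at_unique shuffle_splits_at(1)[OF l r s] shuffle_splits_at(1)[OF l' r' s'] by simp
  have le: "\<forall>x\<in>set l. x \<le> Suc k" "\<forall>x\<in>set l'. x \<le> Suc k"
    using l l' by (auto simp: parking_functions_def)
  have pos: "0 \<notin> set r" "0 \<notin> set r'"
    using r r' by (auto simp: parking_function_iff)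
  have "l' = l" "map ((+) (Suc k)) r' = map ((+) (Suc k)) r"
    using filter_shuffle_shifted[OF le(1) pos(1) s] filter_shuffle_shifted[OF le(2) pos(2)] s'
    by auto
  then show "x = y"
    by (simp add: x_eq y_eq inj_map_eq_map)
next
  fix p assume "p \<in> ?f ` ?I"
  then obtain k l r c s where *: "k \<le> n" "l \<in> parking_functions k" "r \<in> parking_functions (n - k)"
    "s \<in> shuffles l (map ((+) (Suc k)) r)" "c \<in> {1..Suc k}" "p = c # s"
    by auto
  then show "p \<in> parking_functions (Suc n)"
    using shuffle_splits_at(2)[OF *(2-5)] by simp
next
  fix p assume p: "p \<in> parking_functions (Suc n)"
  then obtain c s where cs: "p = c # s"
    by (cases p) (auto simp: parking_function_iff)
  obtain k where "splits_at k s"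
    using splits_at_exists by blast
  then obtain l r where *: "l \<in> parking_functions k" "r \<in> parking_functions (n - k)"
    "s \<in> shuffles l (map ((+) (Suc k)) r)" "c \<in> {1..Suc k}" "k \<le> n"
    using parking_function_split p unfolding cs by metis
  then have "(k, (l, r), c, s) \<in> ?I"
    by auto
  then show "p \<in> ?f ` ?I"
    unfolding cs by (rule rev_image_eqI) simp
qed

lemma sum_list_shuffles:
  assumes "s \<in> shuffles l r"
  shows "sum_list s = sum_list l + (sum_list r :: nat)"
  using assms by (induction l r arbitrary: s rule: shuffles.induct) auto

text \<open>
  Of the triangular number \<open>(k + m + 1) * (k + m + 2) / 2\<close>, the triangular numbers of \<open>k\<close> and \<open>m\<close>
  leave \<open>(k + 1) * (m + 1)\<close>. The shift by \<open>k + 1\<close> consumes \<open>(k + 1) * m\<close> of it and the first entry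
  consumes \<open>c\<close>.
\<close>

lemma area_shuffle:
  assumes l: "l \<in> parking_functions k" and r: "r \<in> parking_functions m"
    and s: "s \<in> shuffles l (map ((+) (Suc k)) r)" and c: "c \<in> {1..Suc k}"
  shows "area (c # s) = real (Suc k - c) + (area l + area r)"
proof -
  have len: "length l = k" "length r = m"
    using l r by (auto simp: parking_function_iff)
  have "sum_list (map ((+) (Suc k)) r) = Suc k * length r + sum_list r"
    by (induction r) auto
  then have "sum_list s = sum_list l + (Suc k * m + sum_list r)"
    using sum_list_shuffles[OF s] len by simp
  moreover have "length s = k + m"
    using length_shuffles[OF s] len by simp
  ultimately show ?thesis
    using c len unfolding area_def by (simp add: of_nat_diff field_simps)
qed

text \<open>
  The \<open>n choose k\<close> shuffles of two parking functions with disjoint sets of entries all contribute the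
  same area, and \<open>k + 1 - c\<close> runs over \<open>{0..k}\<close>.
\<close>

lemma sum_parking_functions_Suc:
  fixes \<phi> :: "real \<Rightarrow> real"
  shows "(\<Sum>p\<in>parking_functions (Suc n). \<phi> (area p)) =
    (\<Sum>k\<le>n. real (n choose k) * (\<Sum>l\<in>parking_functions k. \<Sum>r\<in>parking_functions (n - k).
       \<Sum>i\<le>k. \<phi> (real i + (area l + area r))))"
proof -
  have "(\<Sum>p\<in>parking_functions (Suc n). \<phi> (area p)) =
    (\<Sum>(k, (l, r), c, s)\<in>(SIGMA k:{..n}. SIGMA lr:parking_functions k \<times> parking_functions (n - k).
        {1..Suc k} \<times> shuffles (fst lr) (map ((+) (Suc k)) (snd lr))). \<phi> (area (c # s)))"
    by (subst sum.reindex_bij_betw[OF bij_betw_parking_split, symmetric])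
      (simp add: case_prod_unfold)
  also have "\<dots> = (\<Sum>k\<le>n. \<Sum>(l, r)\<in>parking_functions k \<times> parking_functions (n - k).
      \<Sum>(c, s)\<in>{1..Suc k} \<times> shuffles l (map ((+) (Suc k)) r). \<phi> (area (c # s)))"
    by (subst sum.Sigma[symmetric], simp, simp add: finite_parking_functions, rule sum.cong[OF refl],
      subst sum.Sigma[symmetric], simp add: finite_parking_functions, simp, rule sum.cong) auto
  also have "\<dots> = (\<Sum>k\<le>n. \<Sum>(l, r)\<in>parking_functions k \<times> parking_functions (n - k).
      real (n choose k) * (\<Sum>i\<le>k. \<phi> (real i + (area l + area r))))"
  proof (intro sum.cong refl, clarsimp)
    fix k l r assume k: "k \<le> n" and l: "l \<in> parking_functions k"
      and r: "r \<in> parking_functions (n - k)"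
    let ?S = "shuffles l (map ((+) (Suc k)) r)"
    have len: "length l = k" "length r = n - k"
      using l r by (auto simp: parking_function_iff)
    have "set l \<inter> set (map ((+) (Suc k)) r) = {}"
      using l r by (auto simp: parking_functions_def)
    then have card: "card ?S = n choose k"
      using card_disjoint_shuffles len k by fastforce
    have "(\<Sum>(c, s)\<in>{1..Suc k} \<times> ?S. \<phi> (area (c # s))) =
        (\<Sum>(c, s)\<in>{1..Suc k} \<times> ?S. \<phi> (real (Suc k - c) + (area l + area r)))"
      using area_shuffle[OF l r] by (intro sum.cong) auto
    also have "\<dots> = real (n choose k) * (\<Sum>c\<in>{1..Suc k}. \<phi> (real (Suc k - c) + (area l + area r)))"
      by (simp add: sum.cartesian_product[symmetric] card sum_distrib_left del: sum.cl_ivl_Suc)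
    also have "(\<Sum>c\<in>{1..Suc k}. \<phi> (real (Suc k - c) + (area l + area r))) =
        (\<Sum>i\<le>k. \<phi> (real i + (area l + area r)))"
      by (rule sum.reindex_bij_witness[of _ "\<lambda>i. Suc k - i" "\<lambda>c. Suc k - c"]) auto
    finally show "(\<Sum>(c, s)\<in>{Suc 0..Suc k} \<times> ?S. \<phi> (area (c # s))) =
        real (n choose k) * (\<Sum>i\<le>k. \<phi> (real i + (area l + area r)))"
      by (simp only: One_nat_def)
  qed
  also have "\<dots> = (\<Sum>k\<le>n. real (n choose k) * (\<Sum>l\<in>parking_functions k. \<Sum>r\<in>parking_functions (n - k).
       \<Sum>i\<le>k. \<phi> (real i + (area l + area r))))"
    by (simp add: sum.cartesian_product[symmetric] sum_distrib_left)
  finally show ?thesis .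
qed

text \<open>
  Unnormalised moments in the binomial basis. Binomial coefficients behave better than falling
  factorials because Vandermonde's identity makes their sequence multiplicative; \<open>gchoose\<close> is used since
  the area is a real number.
\<close>

definition binomial_moment :: "nat \<Rightarrow> nat \<Rightarrow> real" where
  "binomial_moment k n = (\<Sum>p\<in>parking_functions n. area p gchoose k)"

text \<open>
  Vandermonde's identity separates the three summands of the area, and the uniform one contributes
  \<open>\<Sum>i\<le>j. i choose a = (j + 1) choose (a + 1)\<close>.
\<close>

lemma binomial_moment_Suc:
  "binomial_moment k (Suc n) =
    (\<Sum>j\<le>n. real (n choose j) * (\<Sum>a\<le>k. real (Suc j choose Suc a) *
       (\<Sum>b\<le>k - a. binomial_moment b j * binomial_moment (k - a - b) (n - j))))"
proof -
  have V: "(\<Sum>i\<le>j. (real i + (x + y)) gchoose k) =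
     (\<Sum>a\<le>k. real (Suc j choose Suc a) * (\<Sum>b\<le>k - a. (x gchoose b) * (y gchoose (k - a - b))))"
    for j and x y :: real
  proof -
    have "(\<Sum>i\<le>j. (real i + (x + y)) gchoose k) =
        (\<Sum>i\<le>j. \<Sum>a\<le>k. real (i choose a) * ((x + y) gchoose (k - a)))"
      by (simp add: gbinomial_Vandermonde[symmetric] binomial_gbinomial atMost_atLeast0)
    also have "\<dots> = (\<Sum>a\<le>k. (\<Sum>i\<le>j. real (i choose a)) * ((x + y) gchoose (k - a)))"
      by (subst sum.swap) (simp add: sum_distrib_right)
    also have "\<dots> = (\<Sum>a\<le>k. real (Suc j choose Suc a) * ((x + y) gchoose (k - a)))"
      by (simp only: of_nat_sum[symmetric] sum_choose_upper)
    finally show ?thesis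
      by (simp add: gbinomial_Vandermonde[symmetric] atMost_atLeast0)
  qed
  have "(\<Sum>l\<in>L. \<Sum>r\<in>R. \<Sum>i\<le>j. (real i + (area l + area r)) gchoose k) =
      (\<Sum>a\<le>k. real (Suc j choose Suc a) *
        (\<Sum>b\<le>k - a. (\<Sum>l\<in>L. area l gchoose b) * (\<Sum>r\<in>R. area r gchoose (k - a - b))))"
    for L R j
  proof -
    have "(\<Sum>l\<in>L. \<Sum>r\<in>R. \<Sum>i\<le>j. (real i + (area l + area r)) gchoose k) =
       (\<Sum>a\<le>k. \<Sum>l\<in>L. \<Sum>r\<in>R. \<Sum>b\<le>k - a. real (Suc j choose Suc a) *
         ((area l gchoose b) * (area r gchoose (k - a - b))))"
      unfolding V sum.swap[where A = R and B = "{..k}"] sum.swap[where A = L and B = "{..k}"]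
      by (simp add: sum_distrib_left)
    also have "\<dots> = (\<Sum>a\<le>k. \<Sum>b\<le>k - a. \<Sum>l\<in>L. \<Sum>r\<in>R. real (Suc j choose Suc a) *
         ((area l gchoose b) * (area r gchoose (k - a - b))))"
      by (intro sum.cong refl) (subst sum.swap[where A = R], subst sum.swap[where A = L], rule refl)
    finally show ?thesis
      unfolding sum_product by (simp only: sum_distrib_left)
  qed
  then show ?thesis
    unfolding binomial_moment_def sum_parking_functions_Suc[where \<phi> = "\<lambda>x. x gchoose k"]
    by (simp only:)
qed

section \<open>Generating functions of the binomial moments\<close>

lemma fps_XD_nth [simp]: "fps_XD f $ n = of_nat n * f $ n"
  by (cases n) (simp_all add: fps_XD_def)

lemma fps_XD_mult: "fps_XD (f * g) = fps_XD f * g + f * fps_XD g" for f g :: "'a::comm_ring_1 fps"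
  by (simp add: fps_XD_def algebra_simps)

lemma fps_XD_diff: "fps_XD (f - g) = fps_XD f - fps_XD g" for f g :: "'a::comm_ring_1 fps"
  by (simp add: fps_XD_def algebra_simps)

text \<open>
  The operator \<open>\<theta> choose m = \<theta> (\<theta> - 1) \<cdots> (\<theta> - m + 1) / m!\<close> for the Euler operator
  \<open>\<theta> = z d/dz\<close>, which acts on \<open>z ^ n\<close> as multiplication by \<open>n\<close>.
\<close>

definition fps_XD_choose :: "nat \<Rightarrow> real fps \<Rightarrow> real fps" where
  "fps_XD_choose m f = Abs_fps (\<lambda>n. of_nat (n choose m) * f $ n)"

lemma fps_XD_choose_nth [simp]: "fps_XD_choose m f $ n = of_nat (n choose m) * f $ n"
  by (simp add: fps_XD_choose_def)

lemma fps_XD_choose_0 [simp]: "fps_XD_choose 0 f = f"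
  by (rule fps_ext) simp

lemma fps_XD_choose_1 [simp]: "fps_XD_choose (Suc 0) f = fps_XD f"
  by (rule fps_ext) simp

lemma fps_XD_choose_Suc:
  "fps_XD_choose (Suc m) f =
     fps_const (1 / real (Suc m)) * (fps_XD (fps_XD_choose m f) - fps_const (real m) * fps_XD_choose m f)"
proof (rule fps_ext)
  fix n
  have "real (Suc m) * real (n choose Suc m) + real m * real (n choose m) = real n * real (n choose m)"
    using gbinomial_mult_1[of "real n" m] by (simp add: binomial_gbinomial)
  then have choose: "real (n choose Suc m) = (real n * real (n choose m) - real m * real (n choose m)) / real (Suc m)"
    by (simp add: field_simps)
  show "fps_XD_choose (Suc m) f $ n = (fps_const (1 / real (Suc m)) *
      (fps_XD (fps_XD_choose m f) - fps_const (real m) * fps_XD_choose m f)) $ n"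
    by (simp add: choose field_simps del: of_nat_Suc binomial_Suc_Suc)
qed

text \<open>
  The exponent exceeds the length by one. In the recurrence this turns the factor \<open>(j + 1) choose (a + 1)\<close>
  into the action of \<open>\<theta> choose (a + 1)\<close> on the coefficient of \<open>z ^ (j + 1)\<close>.
\<close>

definition moment_fps :: "nat \<Rightarrow> real fps" where
  "moment_fps k = Abs_fps (\<lambda>n. if n = 0 then 0 else binomial_moment k (n - 1) / fact (n - 1))"

lemma moment_fps_nth_0 [simp]: "moment_fps k $ 0 = 0"
  by (simp add: moment_fps_def)

lemma moment_fps_nth_Suc: "moment_fps k $ Suc n = binomial_moment k n / fact n"
  by (simp add: moment_fps_def)

lemma parking_functions_0: "parking_functions 0 = {[]}"
  by (auto simp: parking_functions_def)

lemma moment_fps_nth_1: "moment_fps k $ Suc 0 = (if k = 0 then 1 else 0)"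
  by (simp add: moment_fps_nth_Suc binomial_moment_def parking_functions_0 area_def gbinomial_0_left)

lemma moment_fps_functional_equation:
  "fps_XD (moment_fps k) - moment_fps k =
    (\<Sum>a\<le>k. \<Sum>b\<le>k - a. fps_XD_choose (Suc a) (moment_fps b) * moment_fps (k - a - b))"
proof (rule fps_ext)
  fix N
  consider "N = 0" | "N = 1" | n where "N = Suc (Suc n)"
    by (metis One_nat_def not0_implies_Suc)
  then show "(fps_XD (moment_fps k) - moment_fps k) $ N =
    (\<Sum>a\<le>k. \<Sum>b\<le>k - a. fps_XD_choose (Suc a) (moment_fps b) * moment_fps (k - a - b)) $ N"
  proof cases
    case 3
    have prod: "(fps_XD_choose (Suc a) (moment_fps b) * moment_fps c) $ N =
      (\<Sum>j\<le>n. real (n choose j) * (real (Suc j choose Suc a) *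
         (binomial_moment b j * binomial_moment c (n - j)))) / fact n" for a b c
    proof -
      have "(fps_XD_choose (Suc a) (moment_fps b) * moment_fps c) $ N =
        (\<Sum>i\<le>Suc (Suc n). fps_XD_choose (Suc a) (moment_fps b) $ i * moment_fps c $ (Suc (Suc n) - i))"
        by (simp only: fps_mult_nth 3 atLeast0AtMost)
      also have "\<dots> = (\<Sum>i\<le>Suc n. fps_XD_choose (Suc a) (moment_fps b) $ Suc i * moment_fps c $ (Suc n - i))"
        by (subst sum.atMost_Suc_shift) simp
      also have "\<dots> = (\<Sum>i\<le>n. fps_XD_choose (Suc a) (moment_fps b) $ Suc i * moment_fps c $ (Suc n - i))"
        by (subst sum.atMost_Suc) simp
      also have "\<dots> = (\<Sum>j\<le>n. real (n choose j) * (real (Suc j choose Suc a) *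
         (binomial_moment b j * binomial_moment c (n - j))) / fact n)"
        by (intro sum.cong refl)
          (simp add: Suc_diff_le moment_fps_nth_Suc binomial_fact del: binomial_Suc_Suc)
      finally show ?thesis
        by (simp add: sum_divide_distrib)
    qed
    have "(\<Sum>a\<le>k. \<Sum>b\<le>k - a. fps_XD_choose (Suc a) (moment_fps b) * moment_fps (k - a - b)) $ N =
      (\<Sum>a\<le>k. \<Sum>b\<le>k - a. \<Sum>j\<le>n. real (n choose j) * (real (Suc j choose Suc a) *
         (binomial_moment b j * binomial_moment (k - a - b) (n - j)))) / fact n"
      by (simp only: fps_sum_nth prod sum_divide_distrib)
    also have "(\<Sum>a\<le>k. \<Sum>b\<le>k - a. \<Sum>j\<le>n. real (n choose j) * (real (Suc j choose Suc a) *
         (binomial_moment b j * binomial_moment (k - a - b) (n - j)))) = binomial_moment k (Suc n)"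
      unfolding binomial_moment_Suc sum_distrib_left
      by (simp only: sum.swap[where A = "{..n}"])
    also have "\<dots> / fact n = (fps_XD (moment_fps k) - moment_fps k) $ N"
    proof -
      have "binomial_moment k (Suc n) / fact n = real (Suc n) * (binomial_moment k (Suc n) / fact (Suc n))"
        by (simp add: fact_Suc del: of_nat_Suc)
      then show ?thesis
        by (simp add: 3 moment_fps_nth_Suc algebra_simps add_divide_distrib del: fact_Suc)
    qed
    finally show ?thesis by simp
  qed (simp_all add: fps_sum_nth)
qed

text \<open>
  The series of the zeroth moments, that is, of the numbers of parking functions. It is the generating
  function of rooted labelled trees, the solution of \<open>T = z * exp T\<close>.
\<close>

abbreviation T :: "real fps" where "T \<equiv> moment_fps 0"

definition Y :: "real fps" where "Y = fps_XD T"

lemma Y_nth_0 [simp]: "Y $ 0 = 0"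
  by (simp add: Y_def)

text \<open>
  The functional equation for \<open>k = 0\<close> is \<open>\<theta> T - T = \<theta> T * T\<close>. It says that \<open>Y = T / (1 - T)\<close>, or that
  \<open>1 + Y\<close> is the inverse of \<open>1 - T\<close>.
\<close>

lemma T_times_Y_plus_1: "T * (1 + Y) = Y"
  using moment_fps_functional_equation[of 0] by (simp add: Y_def algebra_simps)

lemma one_minus_T_inverse: "(1 - T) * (1 + Y) = 1"
  using T_times_Y_plus_1 by (simp add: algebra_simps)

lemma XD_Y: "fps_XD Y = Y * (1 + Y)\<^sup>2"
proof -
  have "fps_XD Y = Y * (1 + Y) + T * fps_XD Y"
    by (subst (1) T_times_Y_plus_1[symmetric], subst fps_XD_mult) (simp add: Y_def fps_XD_def)
  then have "(1 - T) * fps_XD Y = Y * (1 + Y)"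
    by (simp add: algebra_simps)
  then have "((1 - T) * (1 + Y)) * fps_XD Y = Y * (1 + Y)\<^sup>2"
    by (simp add: power2_eq_square mult_ac)
  then show ?thesis
    by (simp add: one_minus_T_inverse)
qed

definition at_Y :: "real poly \<Rightarrow> real fps" where
  "at_Y p = fps_of_poly p oo Y"

lemma at_Y_simps:
  "at_Y (p + q) = at_Y p + at_Y q"
  "at_Y (p - q) = at_Y p - at_Y q"
  "at_Y (p * q) = at_Y p * at_Y q"
  "at_Y (smult c p) = fps_const c * at_Y p"
  "at_Y 0 = 0" "at_Y 1 = 1" "at_Y [:0, 1:] = Y"
  by (simp_all add: at_Y_def fps_of_poly_simps fps_compose_add_distrib fps_compose_sub_distrib
      fps_compose_mult_distrib)

lemma at_Y_one_plus_Y: "at_Y [:1, 1:] = 1 + Y"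
proof -
  have "[:1, 1:] = 1 + [:0, 1::real:]" by (simp add: one_pCons)
  then show ?thesis by (simp only: at_Y_simps)
qed

lemma at_Y_sum: "at_Y (sum f A) = (\<Sum>x\<in>A. at_Y (f x))"
  by (induction A rule: infinite_finite_induct) (simp_all add: at_Y_simps)

lemma XD_at_Y: "fps_XD (at_Y p) = at_Y (pderiv p) * (Y * (1 + Y)\<^sup>2)"
proof -
  have "fps_XD (at_Y p) = (fps_deriv (fps_of_poly p) oo Y) * fps_XD Y"
    by (simp add: fps_XD_def at_Y_def fps_compose_deriv mult_ac)
  then show ?thesis
    by (simp add: XD_Y at_Y_def fps_of_poly_pderiv)
qed

text \<open>
  The Euler operator on \<open>T * \<real>[Y]\<close>, transported to polynomials: by \<open>\<theta> T = T * (1 + Y)\<close> and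
  \<open>\<theta> Y = Y * (1 + Y)\<^sup>2\<close> it becomes \<open>p \<mapsto> Y (1 + Y)\<^sup>2 p' + (1 + Y) p\<close>.
\<close>

definition conj_XD :: "real poly \<Rightarrow> real poly" where
  "conj_XD p = [:0, 1:] * ([:1, 1:] * ([:1, 1:] * pderiv p)) + [:1, 1:] * p"

lemma XD_T_at_Y: "fps_XD (T * at_Y p) = T * at_Y (conj_XD p)"
proof -
  have "fps_XD (T * at_Y p) = T * (1 + Y) * at_Y p + T * (at_Y (pderiv p) * (Y * (1 + Y)\<^sup>2))"
    by (simp add: fps_XD_mult XD_at_Y T_times_Y_plus_1) (simp add: Y_def)
  then show ?thesis
    unfolding conj_XD_def at_Y_simps at_Y_one_plus_Y by (simp add: algebra_simps power2_eq_square)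
qed

text \<open>
  A constant of its own, so that simplification evaluates the argument to an explicit polynomial before
  it is duplicated; unfolding the iterates at once would double the term at every step.
\<close>

definition conj_XD_minus :: "real \<Rightarrow> real poly \<Rightarrow> real poly" where
  "conj_XD_minus c p = conj_XD p - smult c p"

fun conj_XD_choose :: "nat \<Rightarrow> real poly \<Rightarrow> real poly" where
  "conj_XD_choose 0 p = p"
| "conj_XD_choose (Suc m) p = smult (1 / real (Suc m)) (conj_XD_minus (real m) (conj_XD_choose m p))"

lemma XD_choose_T_at_Y: "fps_XD_choose m (T * at_Y p) = T * at_Y (conj_XD_choose m p)"
proof (induction m)
  case (Suc m)
  show ?case
    unfolding fps_XD_choose_Suc Suc XD_T_at_Y conj_XD_choose.simps conj_XD_minus_def at_Y_simps
    by (simp add: algebra_simps)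
qed simp

text \<open>
  Because \<open>T\<close> has no constant term, the coefficient of \<open>z ^ n\<close> in the equation expresses \<open>(n - 1) * U $ n\<close>
  through lower coefficients of \<open>U\<close>. Only the coefficient at \<open>n = 1\<close> remains free.
\<close>

lemma linearised_equation_unique:
  fixes U :: "real fps"
  assumes eq: "fps_XD U - U = fps_XD T * U + fps_XD U * T" and U1: "U $ 1 = 0"
  shows "U = 0"
proof -
  have "U $ n = 0" for n
  proof (induction n rule: less_induct)
    case (less n)
    have "(fps_XD T * U) $ n = 0"
      unfolding fps_mult_nth
    proof (intro sum.neutral ballI)
      fix i assume "i \<in> {0..n}"
      then show "fps_XD T $ i * U $ (n - i) = 0"
        using less[of "n - i"] by (cases "i = 0") auto
    qed
    moreover have "(fps_XD U * T) $ n = 0"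
      unfolding fps_mult_nth
    proof (intro sum.neutral ballI)
      fix i assume "i \<in> {0..n}"
      then show "fps_XD U $ i * T $ (n - i) = 0"
        using less[of i] by (cases "i = n") auto
    qed
    ultimately have "(real n - 1) * U $ n = 0"
      using arg_cong[OF eq, of "\<lambda>f. f $ n"] by (simp add: algebra_simps)
    then show ?case
      using U1 by (cases "n = 1") auto
  qed
  then show ?thesis
    by (intro fps_ext) simp
qed

text \<open>
  In the functional equation, \<open>moment_fps k\<close> occurs on the right-hand side only linearly, in the terms
  \<open>\<theta> T * G\<^sub>k\<close> and \<open>\<theta> G\<^sub>k * T\<close>. The difference to another solution therefore satisfies the
  linearised equation and vanishes. The hypothesis on \<open>f k\<close> is the functional equation after division
  by \<open>T\<close>, in which the remaining factor \<open>T\<close> on the right has been replaced by \<open>Y / (1 + Y)\<close>.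
\<close>

lemma moment_fps_eqI:
  assumes "k > 0" and prev: "\<And>j. j < k \<Longrightarrow> moment_fps j = T * at_Y (f j)"
    and eq: "[:1, 1:] * (conj_XD (f k) - f k) =
      [:0, 1:] * (\<Sum>a\<le>k. \<Sum>b\<le>k - a. conj_XD_choose (Suc a) (f b) * f (k - a - b))"
    and f0: "coeff (f k) 0 = 0"
  shows "moment_fps k = T * at_Y (f k)"
proof -
  define V where "V = T * at_Y (f k)"
  define W where "W = (\<lambda>b. if b = k then V else moment_fps b)"
  define U where "U = moment_fps k - V"
  have W: "W b = T * at_Y (f b)" if "b \<le> k" for b
    using that prev[of b] by (cases "b = k") (simp_all only: W_def V_def if_True if_False simp_thms less_le)
  let ?S = "\<Sum>a\<le>k. \<Sum>b\<le>k - a. conj_XD_choose (Suc a) (f b) * f (k - a - b)"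
  have "(1 + Y) * (fps_XD V - V) = T * at_Y ([:1, 1:] * (conj_XD (f k) - f k))"
    unfolding V_def XD_T_at_Y at_Y_simps at_Y_one_plus_Y by (simp add: algebra_simps)
  also have "\<dots> = T * (Y * at_Y ?S)"
    unfolding eq by (simp only: at_Y_simps(3,7))
  finally have "((1 - T) * (1 + Y)) * (fps_XD V - V) = (1 - T) * (T * (Y * at_Y ?S))"
    by (simp only: mult.assoc)
  also have "(1 - T) * (T * (Y * at_Y ?S)) = ((1 - T) * (1 + Y)) * (T * T * at_Y ?S)"
  proof -
    have "(1 - T) * (T * (Y * at_Y ?S)) = (1 - T) * (T * ((T * (1 + Y)) * at_Y ?S))"
      by (simp only: T_times_Y_plus_1)
    also have "\<dots> = ((1 - T) * (1 + Y)) * (T * T * at_Y ?S)"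
      by (simp only: mult_ac)
    finally show ?thesis .
  qed
  finally have "fps_XD V - V = T * T * at_Y ?S"
    by (simp only: one_minus_T_inverse mult_1_left)
  also have "\<dots> = (\<Sum>a\<le>k. \<Sum>b\<le>k - a. fps_XD_choose (Suc a) (W b) * W (k - a - b))"
    unfolding at_Y_sum sum_distrib_left
  proof (intro sum.cong refl)
    fix a b assume "a \<in> {..k}" "b \<in> {..k - a}"
    then show "T * T * at_Y (conj_XD_choose (Suc a) (f b) * f (k - a - b)) =
        fps_XD_choose (Suc a) (W b) * W (k - a - b)"
      by (simp only: W XD_choose_T_at_Y at_Y_simps(3) atMost_iff) (simp only: mult_ac)
  qed
  finally have V: "fps_XD V - V = \<dots>" .
  have "fps_XD U - U = (fps_XD (moment_fps k) - moment_fps k) - (fps_XD V - V)"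
    by (simp add: U_def fps_XD_diff)
  also have "\<dots> = (\<Sum>a\<le>k. \<Sum>b\<le>k - a. fps_XD_choose (Suc a) (moment_fps b) * moment_fps (k - a - b)
      - fps_XD_choose (Suc a) (W b) * W (k - a - b))"
    by (simp only: V moment_fps_functional_equation sum_subtractf)
  \<comment> \<open>For \<open>a > 0\<close> only moments below \<open>k\<close> occur, where \<open>W\<close> and \<open>moment_fps\<close> agree.\<close>
  also have "\<dots> = (\<Sum>a\<in>{0}. \<Sum>b\<le>k - a. fps_XD_choose (Suc a) (moment_fps b) * moment_fps (k - a - b)
      - fps_XD_choose (Suc a) (W b) * W (k - a - b))"
    by (rule sum.mono_neutral_right) (auto simp: W_def intro!: sum.neutral)
  also have "\<dots> = (\<Sum>b\<le>k. fps_XD (moment_fps b) * moment_fps (k - b) - fps_XD (W b) * W (k - b))"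
    by simp
  also have "\<dots> = (\<Sum>b\<in>{0, k}. fps_XD (moment_fps b) * moment_fps (k - b) - fps_XD (W b) * W (k - b))"
    by (rule sum.mono_neutral_right) (auto simp: W_def)
  also have "\<dots> = fps_XD T * U + fps_XD U * T"
    using \<open>k > 0\<close> by (simp add: W_def U_def fps_XD_diff algebra_simps)
  finally have "fps_XD U - U = fps_XD T * U + fps_XD U * T" .
  moreover have "U $ 1 = 0"
    using \<open>k > 0\<close> f0 by (simp add: U_def V_def moment_fps_nth_1 at_Y_def)
  ultimately have "U = 0"
    by (rule linearised_equation_unique)
  then show ?thesis
    by (simp add: U_def V_def)
qed

section \<open>The polynomials of the first five moments\<close>

text \<open>
  The polynomials \<open>f\<^sub>k\<close> with \<open>G\<^sub>k = T * f\<^sub>k(Y)\<close>. With the previous polynomials at hand the functional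
  equation becomes \<open>Y * (1 + Y) * ((1 + Y) * f' - f) = S\<close> for a known polynomial \<open>S\<close>. This is a first-order
  recurrence for the coefficients of \<open>f = f\<^sub>k\<close>, whose solution is fixed, for \<open>k > 0\<close>, by \<open>f(0) = 0\<close>.
\<close>

definition moment_poly :: "nat \<Rightarrow> real poly" where
  "moment_poly k =
     [1,
      [:0, 0, 1 / 2:],
      [:0, 0, 0, 1, 37 / 24, 5 / 8:],
      [:0, 0, 0, 1 / 6, 23 / 6, 91 / 8, 677 / 48, 395 / 48, 15 / 8:],
      [:0, 0, 0, 0, 15 / 8, 73 / 3, 23087 / 240, 3055 / 16, 83777 / 384, 169117 / 1152,
        20905 / 384, 1105 / 128:],
      [:0, 0, 0, 0, 5 / 12, 849 / 40, 4433 / 20, 91123 / 90, 252785 / 96, 6251927 / 1440,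
        10918351 / 2304, 2640575 / 768, 3693455 / 2304, 335275 / 768, 1695 / 32:]] ! k"

lemmas poly_arith = conj_XD_def conj_XD_minus_def pderiv_pCons one_pCons numeral_poly moment_poly_def

lemma moment_fps_0: "moment_fps 0 = T * at_Y (moment_poly 0)"
  by (simp add: at_Y_simps moment_poly_def)

text \<open>
  In each of the following proofs the sums are expanded first, while the operators are kept folded; only
  then is polynomial arithmetic applied. Otherwise the operators would be unfolded below the
  summation, where their index is still a variable.
\<close>

lemma moment_fps_1: "moment_fps 1 = T * at_Y (moment_poly 1)"
proof (rule moment_fps_eqI)
  show "moment_fps j = T * at_Y (moment_poly j)" if "j < 1" for j
    using that moment_fps_0 by (auto simp: numeral_eq_Suc less_Suc_eq)
  show "[:1, 1:] * (conj_XD (moment_poly 1) - moment_poly 1) =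
    [:0, 1:] * (\<Sum>a\<le>1. \<Sum>b\<le>1 - a. conj_XD_choose (Suc a) (moment_poly b) * moment_poly (1 - a - b))"
    by (simp add: eval_nat_numeral del: conj_XD_choose.simps mult_pCons_left mult_pCons_right,
      simp add: poly_arith eval_nat_numeral)
qed (simp_all add: moment_poly_def)

lemma moment_fps_2: "moment_fps 2 = T * at_Y (moment_poly 2)"
proof (rule moment_fps_eqI)
  show "moment_fps j = T * at_Y (moment_poly j)" if "j < 2" for j
    using that moment_fps_0 moment_fps_1 by (auto simp: numeral_eq_Suc less_Suc_eq)
  show "[:1, 1:] * (conj_XD (moment_poly 2) - moment_poly 2) =
    [:0, 1:] * (\<Sum>a\<le>2. \<Sum>b\<le>2 - a. conj_XD_choose (Suc a) (moment_poly b) * moment_poly (2 - a - b))"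
    by (simp add: eval_nat_numeral del: conj_XD_choose.simps mult_pCons_left mult_pCons_right,
      simp add: poly_arith eval_nat_numeral)
qed (simp_all add: moment_poly_def)

lemma moment_fps_3: "moment_fps 3 = T * at_Y (moment_poly 3)"
proof (rule moment_fps_eqI)
  show "moment_fps j = T * at_Y (moment_poly j)" if "j < 3" for j
    using that moment_fps_0 moment_fps_1 moment_fps_2 by (auto simp: numeral_eq_Suc less_Suc_eq)
  show "[:1, 1:] * (conj_XD (moment_poly 3) - moment_poly 3) =
    [:0, 1:] * (\<Sum>a\<le>3. \<Sum>b\<le>3 - a. conj_XD_choose (Suc a) (moment_poly b) * moment_poly (3 - a - b))"
    by (simp add: eval_nat_numeral del: conj_XD_choose.simps mult_pCons_left mult_pCons_right,
      simp add: poly_arith eval_nat_numeral)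
qed (simp_all add: moment_poly_def)

lemma moment_fps_4: "moment_fps 4 = T * at_Y (moment_poly 4)"
proof (rule moment_fps_eqI)
  show "moment_fps j = T * at_Y (moment_poly j)" if "j < 4" for j
    using that moment_fps_0 moment_fps_1 moment_fps_2 moment_fps_3 by (auto simp: numeral_eq_Suc less_Suc_eq)
  show "[:1, 1:] * (conj_XD (moment_poly 4) - moment_poly 4) =
    [:0, 1:] * (\<Sum>a\<le>4. \<Sum>b\<le>4 - a. conj_XD_choose (Suc a) (moment_poly b) * moment_poly (4 - a - b))"
    by (simp add: eval_nat_numeral del: conj_XD_choose.simps mult_pCons_left mult_pCons_right,
      simp add: poly_arith eval_nat_numeral)
qed (simp_all add: moment_poly_def)

lemma moment_fps_5: "moment_fps 5 = T * at_Y (moment_poly 5)"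
proof (rule moment_fps_eqI)
  show "moment_fps j = T * at_Y (moment_poly j)" if "j < 5" for j
    using that moment_fps_0 moment_fps_1 moment_fps_2 moment_fps_3 moment_fps_4 by (auto simp: numeral_eq_Suc less_Suc_eq)
  show "[:1, 1:] * (conj_XD (moment_poly 5) - moment_poly 5) =
    [:0, 1:] * (\<Sum>a\<le>5. \<Sum>b\<le>5 - a. conj_XD_choose (Suc a) (moment_poly b) * moment_poly (5 - a - b))"
    by (simp add: eval_nat_numeral del: conj_XD_choose.simps mult_pCons_left mult_pCons_right,
      simp add: poly_arith eval_nat_numeral)
qed (simp_all add: moment_poly_def)

section \<open>The fifth moment\<close>

text \<open>
  Horner's scheme for a polynomial in \<open>\<theta> - 1\<close> with coefficient list \<open>cs\<close>, constant term first.
\<close>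

fun conj_XD_poly :: "real list \<Rightarrow> real poly \<Rightarrow> real poly" where
  "conj_XD_poly [] p = 0"
| "conj_XD_poly (c # cs) p = smult c p + conj_XD_minus 1 (conj_XD_poly cs p)"

text \<open>
  The operator \<open>\<theta> - 1\<close> multiplies the coefficient of \<open>z ^ (n + 1)\<close> by \<open>n\<close>.
\<close>

lemma conj_XD_poly_nth:
  "(T * at_Y (conj_XD_poly cs p)) $ Suc n = horner_sum id (real n) cs * (T * at_Y p) $ Suc n"
proof (induction cs)
  case (Cons c cs)
  have "T * at_Y (conj_XD_poly (c # cs) p) = fps_const c * (T * at_Y p) +
      (fps_XD (T * at_Y (conj_XD_poly cs p)) - T * at_Y (conj_XD_poly cs p))"
    unfolding XD_T_at_Y
    by (simp add: conj_XD_minus_def at_Y_simps algebra_simps)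
  then have "(T * at_Y (conj_XD_poly (c # cs) p)) $ Suc n =
      c * (T * at_Y p) $ Suc n + real n * (T * at_Y (conj_XD_poly cs p)) $ Suc n"
    by (simp only: fps_add_nth fps_sub_nth fps_mult_left_const_nth fps_XD_nth)
      (simp add: algebra_simps)
  then show ?case
    by (simp only: Cons) (simp add: algebra_simps)
qed (simp add: at_Y_simps)

text \<open>
  The coefficients, by increasing powers of \<open>n\<close>, of the two polynomials in the closed form of the fifth
  factorial moment: \<open>fifth_coeffs_0\<close> for the free part, \<open>fifth_coeffs_1\<close> for the multiplier of the
  expected area.
\<close>

definition fifth_coeffs_0 :: "real list" where
  "fifth_coeffs_0 = [0, 392763901 / 11612160, 24676991 / 483840, - (94846903 / 11612160),
     - (30773609 / 725760), - (99955651 / 3870720), - (2170159 / 290304), - (105845 / 110592)]"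

definition fifth_coeffs_1 :: "real list" where
  "fifth_coeffs_1 = [1024580441 / 5806080, 159943787 / 362880, 826358527 / 1935360, 1111349 / 5184,
     9832585 / 165888, 1005 / 128, 565 / 2048]"

text \<open>
  Here the closed form of the fifth moment is decided: both sides are polynomials of degree 14 in \<open>Y\<close>, and
  \<open>120 = 5!\<close> turns the binomial moment into the factorial moment.
\<close>

lemma moment_poly_5:
  "smult 120 (moment_poly 5) = conj_XD_poly fifth_coeffs_0 (moment_poly 0) + conj_XD_poly fifth_coeffs_1 (moment_poly 1)"
  by (simp add: fifth_coeffs_0_def fifth_coeffs_1_def poly_arith)

lemma binomial_moment_5:
  "120 * binomial_moment 5 n =
     horner_sum id (real n) fifth_coeffs_0 * binomial_moment 0 n + horner_sum id (real n) fifth_coeffs_1 * binomial_moment 1 n"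
proof -
  have "fps_const 120 * moment_fps 5 = T * at_Y (smult 120 (moment_poly 5))"
    by (simp only: moment_fps_5 at_Y_simps mult_ac)
  also have "\<dots> = T * at_Y (conj_XD_poly fifth_coeffs_0 (moment_poly 0)) + T * at_Y (conj_XD_poly fifth_coeffs_1 (moment_poly 1))"
    by (simp only: moment_poly_5 at_Y_simps distrib_left)
  finally have eq: "(fps_const 120 * moment_fps 5) $ Suc n = \<dots> $ Suc n"
    by simp
  show ?thesis
    using eq unfolding fps_add_nth conj_XD_poly_nth moment_fps_0[symmetric] moment_fps_1[symmetric]
    by (simp add: moment_fps_nth_Suc field_simps)
qed

lemma binomial_moment_0: "binomial_moment 0 n = real (card (parking_functions n))"
  by (simp add: binomial_moment_def)

lemma binomial_moment_0_pos: "binomial_moment 0 n > 0"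
  using finite_parking_functions parking_functions_nonempty
  by (simp add: binomial_moment_0 card_gt_0_iff)

lemma area_factorial_moment_eq:
  "area_factorial_moment k n = fact k * binomial_moment k n / binomial_moment 0 n"
proof -
  have "(\<Prod>j<k. x - real j) = fact k * (x gchoose k)" for x :: real
    by (simp add: gbinomial_prod_rev atLeast0LessThan)
  then show ?thesis
    unfolding area_factorial_moment_def random_parking_function_def
    by (simp add: integral_pmf_of_set finite_parking_functions parking_functions_nonempty
        binomial_moment_0 binomial_moment_def sum_distrib_left)
qed

lemma expected_area_eq: "expected_area n = binomial_moment 1 n / binomial_moment 0 n"
  using area_factorial_moment_eq[of 1 n]
  by (simp add: area_factorial_moment_def expected_area_def)

section \<open>The expected area and Ramanujan's Q-function\<close>

definition T_over_X :: "real fps" where "T_over_X = fps_shift 1 T"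

lemma T_eq_X_times: "T = fps_X * T_over_X"
  unfolding T_over_X_def by (rule fps_ext) simp

lemma T_over_X_nth_0: "T_over_X $ 0 = 1"
  by (simp add: T_over_X_def moment_fps_nth_1)

lemma XD_T_over_X: "fps_XD T_over_X = T_over_X * Y"
proof -
  have "fps_X * (fps_XD T_over_X) = fps_X * (T_over_X * Y)"
  proof -
    have "fps_XD T = T + fps_X * fps_XD T_over_X"
      unfolding T_eq_X_times fps_XD_mult by (simp add: fps_XD_def algebra_simps)
    then show ?thesis
      using T_times_Y_plus_1 T_eq_X_times by (simp add: Y_def algebra_simps)
  qed
  then show ?thesis by simp
qed

lemma XD_T_over_X_power: "fps_XD (T_over_X ^ a) = of_nat a * (T_over_X ^ a * Y)"
proof (induction a)
  case (Suc a)
  have "fps_XD (T_over_X ^ Suc a) = fps_XD T_over_X * T_over_X ^ a + T_over_X * fps_XD (T_over_X ^ a)"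
    by (simp add: fps_XD_mult)
  then show ?case
    by (simp add: Suc XD_T_over_X algebra_simps)
qed (simp add: fps_XD_def)

lemma T_over_X_power_times_Y: "T_over_X ^ a * Y = fps_X * (T_over_X ^ Suc a * (1 + Y))"
  using T_times_Y_plus_1 unfolding T_eq_X_times by (simp add: mult_ac)

text \<open>
  A form of Lagrange inversion. Write \<open>F = T / z\<close>. From \<open>\<theta> F\<^sup>a = a F\<^sup>a Y\<close> and
  \<open>F\<^sup>a Y = z F\<^sup>a\<^sup>+\<^sup>1 (1 + Y)\<close> the coefficient of \<open>F\<^sup>a (1 + Y)\<close> at \<open>n + 1\<close> is \<open>(a + n + 1) / (n + 1)\<close> times that of
  \<open>F\<^sup>a\<^sup>+\<^sup>1 (1 + Y)\<close> at \<open>n\<close>. Passing from \<open>n + 1\<close> to \<open>n\<close> while raising \<open>a\<close> leaves the base \<open>a + n + 1\<close>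
  unchanged, so the induction must generalise over \<open>a\<close>.
\<close>

lemma T_over_X_power_times_Y1_nth: "(T_over_X ^ a * (1 + Y)) $ n = (real a + real n) ^ n / fact n"
proof (induction n arbitrary: a)
  case 0
  then show ?case by (simp add: T_over_X_nth_0 fps_power_zeroth)
next
  case (Suc n)
  let ?w = "(T_over_X ^ Suc a * (1 + Y)) $ n"
  have shift: "(T_over_X ^ a * Y) $ Suc n = ?w"
    by (simp only: T_over_X_power_times_Y fps_X_mult_nth) simp
  have "real (Suc n) * T_over_X ^ a $ Suc n = real a * ?w"
    using arg_cong[OF XD_T_over_X_power, of "\<lambda>f. f $ Suc n" a]
    by (simp only: fps_XD_nth fps_of_nat[symmetric] fps_mult_left_const_nth shift)
  then have "T_over_X ^ a $ Suc n = real a * ?w / real (Suc n)"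
    by (simp add: field_simps del: of_nat_Suc power_Suc)
  then have "(T_over_X ^ a * (1 + Y)) $ Suc n = real a * ?w / real (Suc n) + ?w"
    by (simp only: distrib_left fps_add_nth shift mult_1_right)
  also have "\<dots> = (real a + real (Suc n)) / real (Suc n) * ?w"
    by (simp add: field_simps del: of_nat_Suc power_Suc)
  also have "?w = (real a + real (Suc n)) ^ n / fact n"
    by (simp add: Suc add_ac del: power_Suc)
  finally show ?case
    by (simp add: fact_Suc del: of_nat_Suc)
qed

lemma T_power_times_Y1_nth:
  "(T ^ j * (1 + Y)) $ N = (if j \<le> N then real N ^ (N - j) / fact (N - j) else 0)"
proof -
  have eq: "T ^ j * (1 + Y) = fps_X ^ j * (T_over_X ^ j * (1 + Y))"
    unfolding T_eq_X_times power_mult_distrib by (simp add: mult_ac)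
  show ?thesis
    unfolding eq by (auto simp: fps_X_power_mult_nth T_over_X_power_times_Y1_nth simp flip: of_nat_add)
qed

lemma T_nth: "0 < N \<Longrightarrow> T $ N = real N ^ (N - 1) / fact N"
proof -
  assume "0 < N"
  have "Y $ N = real N ^ (N - 1) / fact (N - 1)"
    using T_power_times_Y1_nth[of 1 N] T_times_Y_plus_1 \<open>0 < N\<close> by simp
  then show ?thesis
    using \<open>0 < N\<close> by (cases N) (simp_all add: Y_def field_simps del: of_nat_Suc)
qed

text \<open>
  Since \<open>1 + Y = 1 / (1 - T)\<close>, this is the expansion \<open>T * (1 + Y)\<^sup>2 = \<Sum>j\<ge>1. T ^ j * (1 + Y)\<close>. It is stopped
  after \<open>N\<close> terms, because the remainder is divisible by \<open>z ^ (N + 1)\<close>.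
\<close>

lemma T_times_Y1_squared_nth:
  "(T * (1 + Y)\<^sup>2) $ N = (\<Sum>j=1..N. real N ^ (N - j) / fact (N - j))"
proof -
  have expand: "T * (1 + Y)\<^sup>2 = (\<Sum>j=1..m. T ^ j * (1 + Y)) + T ^ Suc m * (1 + Y)\<^sup>2" for m
  proof (induction m)
    case (Suc m)
    have "T * (1 + Y)\<^sup>2 = Y * (1 + Y)"
      by (simp only: power2_eq_square mult.assoc[symmetric] T_times_Y_plus_1)
    then have "(1 + Y)\<^sup>2 = (1 + Y) + T * (1 + Y)\<^sup>2"
      by (simp add: power2_eq_square algebra_simps)
    then have "T ^ Suc m * (1 + Y)\<^sup>2 = T ^ Suc m * (1 + Y) + T ^ Suc (Suc m) * (1 + Y)\<^sup>2"
      by (metis (no_types, lifting) distrib_left mult.assoc power_Suc2)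
    then show ?case
      using Suc by simp
  qed simp
  have "(T ^ Suc N * (1 + Y)\<^sup>2) $ N = (fps_X ^ Suc N * (T_over_X ^ Suc N * (1 + Y)\<^sup>2)) $ N"
    unfolding T_eq_X_times power_mult_distrib by (simp only: mult_ac)
  also have "\<dots> = 0"
    by (simp only: fps_X_power_mult_nth) simp
  finally have "(T * (1 + Y)\<^sup>2) $ N = (\<Sum>j=1..N. (T ^ j * (1 + Y)) $ N)"
    by (subst expand[of N]) (simp only: fps_add_nth fps_sum_nth add_0_right)
  also have "\<dots> = (\<Sum>j=1..N. real N ^ (N - j) / fact (N - j))"
    by (rule sum.cong) (auto simp: T_power_times_Y1_nth)
  finally show ?thesis .
qed

definition ramanujan_Q :: "nat \<Rightarrow> real" where
  "ramanujan_Q n = (\<Sum>k=1..n. fact n / (fact (n - k) * real n ^ k))"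

text \<open>
  From \<open>f\<^sub>1 = Y\<^sup>2 / 2\<close> one has \<open>G\<^sub>1 = T * Y\<^sup>2 / 2\<close>, and \<open>T * Y\<^sup>2 = T * (1 + Y)\<^sup>2 - 2 * Y + T\<close> reduces its
  coefficients to known ones.
\<close>

lemma expected_area_ramanujan_Q:
  "expected_area n = (real (Suc n) * (ramanujan_Q (Suc n) - 2) + 1) / 2"
proof -
  define N where "N = Suc n"
  have N: "N > 0" by (simp add: N_def)
  have "at_Y (moment_poly 1) = fps_const (1 / 2) * Y\<^sup>2"
  proof -
    have "moment_poly 1 = smult (1 / 2) ([:0, 1:] * [:0, 1:])"
      by (simp add: moment_poly_def)
    then show ?thesis
      by (simp only: at_Y_simps power2_eq_square)
  qed
  then have "moment_fps 1 = fps_const (1 / 2) * (T * Y\<^sup>2)"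
    by (simp add: moment_fps_1[simplified])
  also have "T * Y\<^sup>2 = T * (1 + Y)\<^sup>2 - 2 * Y + T"
  proof -
    have "T * Y\<^sup>2 = T * (1 + Y)\<^sup>2 - 2 * (T * (1 + Y)) + T"
      by (simp add: power2_eq_square algebra_simps)
    then show ?thesis
      by (simp only: T_times_Y_plus_1)
  qed
  finally have "moment_fps 1 $ N = ((\<Sum>j=1..N. real N ^ (N - j) / fact (N - j)) - 2 * Y $ N + T $ N) / 2"
    by (simp add: T_times_Y1_squared_nth fps_numeral_simps)
  also have "Y $ N = real N * T $ N"
    by (simp add: Y_def)
  also have "(\<Sum>j=1..N. real N ^ (N - j) / fact (N - j)) = T $ N * (real N * ramanujan_Q N)"
    unfolding ramanujan_Q_def sum_distrib_left T_nth[OF N]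
  proof (rule sum.cong[OF refl])
    fix j assume j: "j \<in> {1..N}"
    have "real N ^ (N - 1) * real N = real N ^ (N - j) * real N ^ j"
      using j N by (simp flip: power_add power_Suc2)
    then show "real N ^ (N - j) / fact (N - j) =
        real N ^ (N - 1) / fact N * (real N * (fact N / (fact (N - j) * real N ^ j)))"
      using N by (simp add: field_simps)
  qed
  finally have "moment_fps 1 $ N = T $ N * ((real N * (ramanujan_Q N - 2) + 1) / 2)"
    by (simp add: algebra_simps)
  moreover have "T $ N \<noteq> 0"
    using N by (simp add: T_nth)
  ultimately have "moment_fps 1 $ N / T $ N = (real N * (ramanujan_Q N - 2) + 1) / 2"
    by simp
  then show ?thesis
    by (simp add: N_def moment_fps_nth_Suc expected_area_eq)
qed

section \<open>Asymptotics of Ramanujan's Q-function\<close>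

text \<open>
  The terms \<open>\<Prod>j=1..k. n / (n + j)\<close> of Ramanujan's companion series \<open>R(n)\<close>, the tail of the
  exponential series from the term \<open>n ^ n / n!\<close> on, relative to that term.
\<close>

definition R_term :: "nat \<Rightarrow> nat \<Rightarrow> real" where
  "R_term n k = fact n * real n ^ k / fact (n + k)"

lemma R_term_0: "R_term n 0 = 1"
  by (simp add: R_term_def)

lemma R_term_nonneg: "R_term n k \<ge> 0"
  by (simp add: R_term_def)

lemma R_term_Suc: "(real n + real (Suc k)) * R_term n (Suc k) = real n * R_term n k"
proof -
  define d where "d = real n + real (Suc k)"
  have "(fact (n + Suc k) :: real) = d * fact (n + k)" "d \<noteq> 0"
    by (simp_all add: d_def)
  then show ?thesis
    unfolding R_term_def d_def[symmetric] by simp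
qed

text \<open>
  The recurrence \<open>R_term_Suc\<close> says \<open>k * r\<^sub>k = n * (r\<^sub>k\<^sub>-\<^sub>1 - r\<^sub>k)\<close>, so this sum telescopes. Summation by parts
  in the same way lowers the cubic weight in the next lemma to a linear one.
\<close>

lemma sum_k_R_term: "(\<Sum>k\<le>K. real k * R_term n k) = real n * (1 - R_term n K)"
proof (induction K)
  case (Suc K)
  then show ?case
    using R_term_Suc[of n K] by (simp add: algebra_simps)
qed (simp add: R_term_0)

lemma sum_k3_R_term:
  "(\<Sum>k\<le>K. real k ^ 3 * R_term n k) =
     real n * ((\<Sum>k<K. (2 * real k + 1) * R_term n k) - real K ^ 2 * R_term n K)"
proof (induction K)
  case (Suc K)
  have "real (Suc K) * R_term n (Suc K) = real n * R_term n K - real n * R_term n (Suc K)"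
    using R_term_Suc[of n K] by (simp add: algebra_simps)
  then have "real (Suc K) ^ 3 * R_term n (Suc K) =
      real (Suc K) ^ 2 * (real n * R_term n K - real n * R_term n (Suc K))"
    by (simp only: power3_eq_cube power2_eq_square mult.assoc)
  then show ?case
    using Suc by (simp add: algebra_simps power2_eq_square)
qed simp

lemma sum_k3_R_term_le:
  assumes "n > 0"
  shows "(\<Sum>k\<le>K. real k ^ 3 * R_term n k) \<le> 4 * real n ^ 2"
proof -
  have A: "(\<Sum>k<K. real k * R_term n k) \<le> real n"
  proof -
    have "(\<Sum>k<K. real k * R_term n k) \<le> (\<Sum>k\<le>K. real k * R_term n k)"
      by (rule sum_mono2) (auto simp: R_term_nonneg)
    also have "\<dots> \<le> real n"
      unfolding sum_k_R_term using R_term_nonneg[of n K] by (simp add: algebra_simps)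
    finally show ?thesis .
  qed
  have "(\<Sum>k<K. R_term n k) \<le> (\<Sum>k<K. of_bool (k = 0) + real k * R_term n k)"
  proof (rule sum_mono)
    fix k
    show "R_term n k \<le> of_bool (k = 0) + real k * R_term n k"
      using mult_right_mono[of 1 "real k" "R_term n k"] R_term_nonneg[of n k] by (cases "k = 0") (auto simp: R_term_0)
  qed
  also have "\<dots> \<le> 1 + real n"
  proof -
    have "(\<Sum>k<K. of_bool (k = 0) :: real) \<le> 1"
      unfolding of_bool_def by (subst sum.delta) auto
    then show ?thesis
      unfolding sum.distrib using A by linarith
  qed
  finally have "(\<Sum>k<K. R_term n k) \<le> 1 + real n" .
  moreover have "(\<Sum>k<K. (2 * real k + 1) * R_term n k) = 2 * (\<Sum>k<K. real k * R_term n k) + (\<Sum>k<K. R_term n k)"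
    by (simp add: algebra_simps sum.distrib sum_distrib_left)
  ultimately have "(\<Sum>k<K. (2 * real k + 1) * R_term n k) \<le> 2 * real n + (1 + real n)"
    using A by linarith
  moreover have "real K ^ 2 * R_term n K \<ge> 0"
    by (simp add: R_term_nonneg)
  ultimately have "(\<Sum>k\<le>K. real k ^ 3 * R_term n k) \<le> real n * (2 * real n + (1 + real n))"
    unfolding sum_k3_R_term by (intro mult_left_mono) auto
  also have "\<dots> \<le> real n * (4 * real n)"
    using assms by (intro mult_left_mono) auto
  finally show ?thesis
    by (simp add: power2_eq_square)
qed

text \<open>
  The terms of \<open>ramanujan_Q\<close>, re-indexed to start at \<open>0\<close> and written as products, which makes them
  comparable with \<open>R_term\<close> factor by factor.
\<close>

definition Q_term :: "nat \<Rightarrow> nat \<Rightarrow> real" where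
  "Q_term n k = (\<Prod>j\<le>k. 1 - real j / real n)"

lemma Q_term_eq: "k < n \<Longrightarrow> Q_term n k = fact n / (fact (n - Suc k) * real n ^ Suc k)"
proof (induction k)
  case 0
  then show ?case by (cases n) (auto simp: Q_term_def)
next
  case (Suc k)
  define d where "d = real n - real (Suc k)"
  have f: "fact (n - Suc k) = d * fact (n - Suc (Suc k))"
    using Suc.prems unfolding d_def by (metis Suc_diff_Suc fact_Suc of_nat_diff less_imp_le_nat)
  have "d \<noteq> 0" "real n \<noteq> 0"
    using Suc.prems by (auto simp: d_def)
  have "Q_term n (Suc k) = Q_term n k * (1 - real (Suc k) / real n)"
    by (simp add: Q_term_def)
  also have "1 - real (Suc k) / real n = d / real n"
    using \<open>real n \<noteq> 0\<close> by (simp add: d_def field_simps)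
  also have "Q_term n k = fact n / (fact (n - Suc k) * real n ^ Suc k)"
    using Suc by simp
  finally show ?case
    using \<open>d \<noteq> 0\<close> \<open>real n \<noteq> 0\<close> by (simp add: f)
qed

lemma ramanujan_Q_eq_sum: "ramanujan_Q n = (\<Sum>k<n. Q_term n k)"
  unfolding ramanujan_Q_def
  by (rule sum.reindex_bij_witness[of _ Suc "\<lambda>k. k - 1"]) (auto simp: Q_term_eq)

text \<open>
  The quotient of the two terms is \<open>\<Prod>j\<le>k. (1 - j / n) * (1 + j / n) = \<Prod>j\<le>k. 1 - j\<^sup>2 / n\<^sup>2\<close>, which lies
  between \<open>1 - k\<^sup>3 / n\<^sup>2\<close> and \<open>1\<close>.
\<close>

lemma Q_term_bounds:
  assumes "k < n"
  shows "Q_term n k \<ge> 0" "Q_term n k \<le> R_term n k"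
    "R_term n k * (1 - real k ^ 3 / real n ^ 2) \<le> Q_term n k"
proof -
  have "Q_term n k \<ge> 0 \<and> Q_term n k \<le> R_term n k \<and> R_term n k * (1 - real k ^ 3 / real n ^ 2) \<le> Q_term n k"
    using assms
  proof (induction k)
    case 0
    then show ?case by (simp add: Q_term_def R_term_0)
  next
    case (Suc k)
    define x where "x = real (Suc k) / real n"
    have x: "0 \<le> x" "x < 1"
      using Suc.prems by (auto simp: x_def divide_simps)
    have Q: "Q_term n (Suc k) = Q_term n k * (1 - x)"
      by (simp add: Q_term_def x_def)
    have R: "R_term n k = (1 + x) * R_term n (Suc k)"
      using R_term_Suc[of n k] Suc.prems by (simp add: x_def field_simps)
    let ?r = "R_term n (Suc k)"
    have IH: "Q_term n k \<ge> 0" "Q_term n k \<le> R_term n k"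
       "R_term n k * (1 - real k ^ 3 / real n ^ 2) \<le> Q_term n k"
      using Suc by auto
    have "Q_term n (Suc k) \<le> (1 + x) * ?r * (1 - x)"
      unfolding Q using IH(2) x R by (intro mult_right_mono) auto
    also have "\<dots> = ?r - x ^ 2 * ?r"
      by (simp add: power2_eq_square algebra_simps)
    also have "\<dots> \<le> ?r"
      by (simp add: R_term_nonneg)
    finally have upper: "Q_term n (Suc k) \<le> ?r" .
    have cube: "real (Suc k) ^ 2 + real k ^ 3 \<le> real (Suc k) ^ 3"
      by (simp add: power2_eq_square power3_eq_cube algebra_simps)
    have "1 - real (Suc k) ^ 3 / real n ^ 2 \<le> 1 - x ^ 2 - real k ^ 3 / real n ^ 2"
    proof -
      have "x ^ 2 = real (Suc k) ^ 2 / real n ^ 2"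
        by (simp add: x_def power_divide)
      then show ?thesis
        using divide_right_mono[OF cube, of "real n ^ 2"]
        by (simp add: add_divide_distrib del: of_nat_Suc)
    qed
    also have "\<dots> \<le> (1 - x ^ 2) * (1 - real k ^ 3 / real n ^ 2)"
    proof -
      have "1 - a - b \<le> (1 - a) * (1 - b)" if "0 \<le> a" "0 \<le> b" for a b :: real
        using that by (simp add: algebra_simps)
      then show ?thesis by simp
    qed
    finally have "?r * (1 - real (Suc k) ^ 3 / real n ^ 2) \<le> ?r * ((1 - x ^ 2) * (1 - real k ^ 3 / real n ^ 2))"
      by (intro mult_left_mono R_term_nonneg)
    also have "\<dots> = R_term n k * (1 - real k ^ 3 / real n ^ 2) * (1 - x)"
      unfolding R by (simp add: power2_eq_square algebra_simps)
    also have "\<dots> \<le> Q_term n (Suc k)"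
      unfolding Q using IH(3) x by (intro mult_right_mono) auto
    finally show ?case
      using upper IH(1) x Q by auto
  qed
  then show "Q_term n k \<ge> 0" "Q_term n k \<le> R_term n k"
    "R_term n k * (1 - real k ^ 3 / real n ^ 2) \<le> Q_term n k"
    by auto
qed

lemma exp_partial_sum:
  assumes "n > 0"
  shows "fact n / real n ^ n * (\<Sum>i<n + K. real n ^ i / fact i) = ramanujan_Q n + (\<Sum>k<K. R_term n k)"
proof (induction K)
  case 0
  have "fact n / real n ^ n * (\<Sum>i<n. real n ^ i / fact i) = (\<Sum>i<n. fact n / real n ^ n * (real n ^ i / fact i))"
    by (rule sum_distrib_left)
  also have "\<dots> = ramanujan_Q n"
    unfolding ramanujan_Q_def
  proof (rule sum.reindex_bij_witness[of _ "\<lambda>k. n - k" "\<lambda>i. n - i"])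
    fix i assume i: "i \<in> {..<n}"
    have "real n ^ n = real n ^ i * real n ^ (n - i)"
      using i by (simp flip: power_add)
    then show "fact n / (fact (n - (n - i)) * real n ^ (n - i)) = fact n / real n ^ n * (real n ^ i / fact i)"
      using i assms by (simp add: field_simps)
  qed auto
  finally show ?case by simp
next
  case (Suc K)
  then show ?case
    using assms by (simp add: R_term_def power_add distrib_left)
qed

text \<open>
  The terms of \<open>R(n)\<close> dominate those of \<open>Q(n)\<close>, and their excess is at most \<open>k\<^sup>3 / n\<^sup>2\<close> times \<open>R_term n k\<close>,
  which sums to at most \<open>4\<close>. As \<open>Q(n) + R(n)\<close> is \<open>n! * exp n / n ^ n\<close>, both bounds follow.
\<close>

lemma ramanujan_Q_exp_bounds:
  assumes "n > 0"
  shows "2 * ramanujan_Q n \<le> fact n * exp (real n) / real n ^ n"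
    and "fact n * exp (real n) / real n ^ n \<le> 2 * ramanujan_Q n + 4"
proof -
  define c where "c = (fact n :: real) / real n ^ n"
  have c: "c > 0" using assms by (simp add: c_def)
  have sums: "(\<lambda>i. real n ^ i / fact i) sums exp (real n)"
    using exp_converges[of "real n"] by (simp add: field_simps scaleR_conv_of_real)
  have "2 * ramanujan_Q n \<le> ramanujan_Q n + (\<Sum>k<n. R_term n k)"
    unfolding ramanujan_Q_eq_sum by (auto intro!: sum_mono Q_term_bounds(2))
  also have "\<dots> = c * (\<Sum>i<n + n. real n ^ i / fact i)"
    using exp_partial_sum[OF assms, of n] by (simp add: c_def)
  also have "\<dots> \<le> c * exp (real n)"
  proof (rule mult_left_mono)
    show "(\<Sum>i<n + n. real n ^ i / fact i) \<le> exp (real n)"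
      using sum_le_suminf[OF sums_summable[OF sums], of "{..<n + n}"] sums_unique[OF sums] by simp
  qed (use c in simp)
  finally show "2 * ramanujan_Q n \<le> fact n * exp (real n) / real n ^ n"
    by (simp add: c_def)
  have partial: "c * (\<Sum>i<n + K. real n ^ i / fact i) \<le> 2 * ramanujan_Q n + 4" if "K \<ge> n" for K
  proof -
    \<comment> \<open>For \<open>k \<ge> n\<close> there is no term of \<open>Q(n)\<close>, but then \<open>k\<^sup>3 / n\<^sup>2 \<ge> 1\<close>, so the same bound on the excess holds.\<close>
    let ?q = "\<lambda>k. if k < n then Q_term n k else 0"
    have "R_term n k \<le> ?q k + real k ^ 3 * R_term n k / real n ^ 2" for k
    proof (cases "k < n")
      case True
      then show ?thesis
        using Q_term_bounds(3)[OF True] by (simp add: algebra_simps)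
    next
      case False
      then have "real n ^ 2 \<le> real k ^ 2" "1 \<le> real k"
        using assms by (auto intro: power_mono)
      then have "real n ^ 2 * 1 \<le> real k ^ 2 * real k"
        by (intro mult_mono) auto
      then have "1 \<le> real k ^ 3 / real n ^ 2"
        using assms by (simp add: power3_eq_cube power2_eq_square field_simps)
      then show ?thesis
        using False mult_right_mono[OF _ R_term_nonneg[of n k], of 1 "real k ^ 3 / real n ^ 2"] by simp
    qed
    then have "(\<Sum>k<K. R_term n k) \<le> (\<Sum>k<K. ?q k + real k ^ 3 * R_term n k / real n ^ 2)"
      by (intro sum_mono)
    also have "\<dots> = (\<Sum>k<K. ?q k) + (\<Sum>k<K. real k ^ 3 * R_term n k) / real n ^ 2"
      by (simp add: sum.distrib sum_divide_distrib)
    also have "(\<Sum>k<K. ?q k) = ramanujan_Q n"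
      unfolding ramanujan_Q_eq_sum using that by (intro sum.mono_neutral_cong_right) auto
    also have "(\<Sum>k<K. real k ^ 3 * R_term n k) \<le> (\<Sum>k\<le>K. real k ^ 3 * R_term n k)"
      by (rule sum_mono2) (auto simp: R_term_nonneg)
    also have "\<dots> \<le> 4 * real n ^ 2"
      by (rule sum_k3_R_term_le[OF assms])
    finally have "(\<Sum>k<K. R_term n k) \<le> ramanujan_Q n + 4"
      using assms by (simp add: divide_right_mono)
    then show ?thesis
      using exp_partial_sum[OF assms, of K] by (simp add: c_def)
  qed
  have "(\<lambda>K. \<Sum>i<n + K. real n ^ i / fact i) \<longlonglongrightarrow> exp (real n)"
    using LIMSEQ_ignore_initial_segment[OF sums[unfolded sums_def], of n] by (simp add: add.commute)
  then have "(\<lambda>K. c * (\<Sum>i<n + K. real n ^ i / fact i)) \<longlonglongrightarrow> c * exp (real n)"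
    by (rule tendsto_mult_left)
  then have "c * exp (real n) \<le> 2 * ramanujan_Q n + 4"
    by (rule LIMSEQ_le_const2) (use partial in blast)
  then show "fact n * exp (real n) / real n ^ n \<le> 2 * ramanujan_Q n + 4"
    by (simp add: c_def)
qed

definition stirling_ratio :: "nat \<Rightarrow> real" where
  "stirling_ratio n = fact n * exp (real n) / (real n ^ n * sqrt (real n))"

lemma stirling_ratio_pos: "n > 0 \<Longrightarrow> stirling_ratio n > 0"
  by (simp add: stirling_ratio_def)

text \<open>
  The decrement of the logarithm is \<open>(n + 1/2) * ln (1 + 1/n) - 1\<close>. The midpoint and the trapezoidal rule
  for the integral of \<open>1/x\<close> over \<open>{n..n + 1}\<close> bound it below by \<open>0\<close> and above by
  \<open>1 / (4 * n) - 1 / (4 * (n + 1))\<close>.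
\<close>

lemma ln_stirling_ratio_step:
  assumes "n > 0"
  shows "ln (stirling_ratio (Suc n)) \<le> ln (stirling_ratio n)"
    and "ln (stirling_ratio n) - 1 / (4 * real n) \<le> ln (stirling_ratio (Suc n)) - 1 / (4 * real (Suc n))"
proof -
  define x where "x = real n"
  have x: "x > 0" using assms by (simp add: x_def)
  have ln_ratio: "ln (stirling_ratio m) = ln (fact m) + real m - (real m + 1 / 2) * ln (real m)" if "m > 0" for m
    using that by (simp add: stirling_ratio_def ln_mult ln_div ln_realpow ln_sqrt algebra_simps)
  have eq: "ln (stirling_ratio n) - ln (stirling_ratio (Suc n)) = (x + 1 / 2) * (ln (x + 1) - ln x) - 1"
  proof -
    have "ln (fact (Suc n)) = ln (x + 1) + ln (fact n :: real)"
      unfolding fact_Suc by (subst ln_mult) (simp_all add: x_def add.commute)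
    then show ?thesis
      using assms by (simp add: ln_ratio x_def algebra_simps del: fact_Suc)
  qed
  have "ln (x + 1) - ln x \<ge> 2 / (2 * x + 1)"
    using ln_inverse_approx_ge[of x "x + 1"] x by simp
  then have ge: "(x + 1 / 2) * (ln (x + 1) - ln x) \<ge> (x + 1 / 2) * (2 / (2 * x + 1))"
    using x by (intro mult_left_mono) auto
  have one: "(x + 1 / 2) * (2 / (2 * x + 1)) = 1"
    using x by (simp add: field_simps)
  have "ln (x + 1) - ln x \<le> (1 / x + 1 / (x + 1)) / 2"
    using ln_inverse_approx_le[of x 1] x by (simp add: field_simps)
  then have le: "(x + 1 / 2) * (ln (x + 1) - ln x) \<le> (x + 1 / 2) * ((1 / x + 1 / (x + 1)) / 2)"
    using x by (intro mult_left_mono) auto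
  have up: "(x + 1 / 2) * ((1 / x + 1 / (x + 1)) / 2) = 1 + (1 / (4 * x) - 1 / (4 * (x + 1)))"
    using x by (simp add: divide_simps) (simp add: algebra_simps)
  show "ln (stirling_ratio (Suc n)) \<le> ln (stirling_ratio n)"
    using eq ge one by linarith
  have "real (Suc n) = x + 1"
    by (simp add: x_def)
  then show "ln (stirling_ratio n) - 1 / (4 * real n) \<le> ln (stirling_ratio (Suc n)) - 1 / (4 * real (Suc n))"
    using eq le up unfolding x_def[symmetric] by (simp only:)
qed

lemma wallis_product_eq:
  "(\<Prod>k=1..n. (4 * real k ^ 2) / (4 * real k ^ 2 - 1)) =
     (4 ^ n * fact n ^ 2 / fact (2 * n)) ^ 2 / (2 * real n + 1)"
proof (induction n)
  case (Suc n)
  define x where "x = real n"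
  define b :: real where "b = 4 ^ n * fact n ^ 2 / fact (2 * n)"
  have x: "2 * x + 1 > 0" "2 * x + 3 > 0" "x + 1 > 0"
    by (simp_all add: x_def)
  have f: "fact (2 * Suc n) = (2 * (x + 1)) * ((2 * x + 1) * fact (2 * n))"
    by (simp add: x_def algebra_simps)
  have f': "fact (Suc n) = (x + 1) * fact n"
    by (simp add: x_def algebra_simps)
  have b': "4 ^ Suc n * fact (Suc n) ^ 2 / fact (2 * Suc n) = b * (2 * (x + 1) / (2 * x + 1))"
    unfolding f f' b_def using x by (simp add: power2_eq_square divide_simps) (simp add: algebra_simps)
  have Suc_x: "real (Suc n) = x + 1"
    by (simp add: x_def)
  have "4 * (x + 1) ^ 2 - 1 = (2 * x + 1) * (2 * x + 3)"
    by (simp add: power2_eq_square algebra_simps)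
  then have "(\<Prod>k=1..Suc n. (4 * real k ^ 2) / (4 * real k ^ 2 - 1)) =
      b ^ 2 / (2 * x + 1) * (4 * (x + 1) ^ 2 / ((2 * x + 1) * (2 * x + 3)))"
    using Suc by (simp add: b_def x_def add.commute)
  also have "\<dots> = (b * (2 * (x + 1) / (2 * x + 1))) ^ 2 / (2 * x + 3)"
    by (simp add: power_mult_distrib power_divide power2_eq_square) (simp add: algebra_simps)
  finally show ?case
    unfolding b' Suc_x by (simp add: algebra_simps)
qed simp

text \<open>
  The powers of \<open>n\<close> and of \<open>exp n\<close> cancel in \<open>n!\<^sup>4 / (2n)!\<^sup>2\<close>, so Wallis' product involves the factorials
  only through \<open>stirling_ratio\<close>. This identifies the limit of the latter.
\<close>

lemma wallis_stirling_ratio: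
  assumes "n > 0"
  shows "(\<Prod>k=1..n. (4 * real k ^ 2) / (4 * real k ^ 2 - 1)) =
    (stirling_ratio n ^ 2 / stirling_ratio (2 * n)) ^ 2 * (real n / (2 * (2 * real n + 1)))"
proof -
  define b :: real where "b = 4 ^ n * fact n ^ 2 / fact (2 * n)"
  define x where "x = real n"
  have x: "x > 0"
    using assms by (simp add: x_def)
  have e: "exp (real (2 * n)) = exp x ^ 2"
    by (simp add: x_def exp_double)
  have p: "real (2 * n) ^ (2 * n) = 4 ^ n * (x ^ n) ^ 2"
    by (simp add: x_def power_mult_distrib power_mult power2_eq_square)
  have "stirling_ratio n ^ 2 / stirling_ratio (2 * n) =
      (fact n ^ 2 * exp x ^ 2 / ((x ^ n) ^ 2 * x)) / (fact (2 * n) * exp x ^ 2 / (4 ^ n * (x ^ n) ^ 2 * sqrt (2 * x)))"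
    unfolding stirling_ratio_def e p using x
    by (simp add: power_divide power_mult_distrib x_def)
  also have "\<dots> = b * (sqrt (2 * x) / x)"
    using x by (simp add: b_def divide_simps)
  finally have "(stirling_ratio n ^ 2 / stirling_ratio (2 * n)) ^ 2 = (b * (sqrt (2 * x) / x)) ^ 2"
    by simp
  also have "\<dots> = b ^ 2 * (2 * x / x ^ 2)"
    using x by (simp add: power_mult_distrib power_divide)
  also have "2 * x / x ^ 2 = 2 / x"
    by (simp add: power2_eq_square)
  finally have "(stirling_ratio n ^ 2 / stirling_ratio (2 * n)) ^ 2 = b ^ 2 * (2 / x)" .
  moreover have "b ^ 2 * (2 / x) * (x / (2 * D)) = b ^ 2 / D" for D
    using x by simp
  ultimately show ?thesis
    unfolding wallis_product_eq b_def[symmetric] x_def[symmetric] by (simp only:)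
qed

text \<open>
  By \<open>ln_stirling_ratio_step\<close> the logarithms decrease, while they increase once \<open>1 / (4 * n)\<close> is
  subtracted. So they converge to some \<open>L\<close> and stay between \<open>L\<close> and \<open>L + 1 / (4 * n)\<close>, and Wallis' product
  forces \<open>exp L = sqrt (2 * pi)\<close>.
\<close>

lemma stirling_ratio_bounds:
  assumes "n > 0"
  shows "sqrt (2 * pi) \<le> stirling_ratio n" "stirling_ratio n \<le> sqrt (2 * pi) * exp (1 / (4 * real n))"
proof -
  define d where "d = (\<lambda>n. ln (stirling_ratio (Suc n)))"
  define e where "e = (\<lambda>n. 1 / (4 * real (Suc n)))"
  have dec: "decseq d"
    unfolding d_def by (rule decseq_SucI) (rule ln_stirling_ratio_step, simp)
  have inc: "incseq (\<lambda>n. d n - e n)"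
    unfolding d_def e_def by (rule incseq_SucI) (rule ln_stirling_ratio_step, simp)
  have e0: "e \<longlonglongrightarrow> 0"
    unfolding e_def by real_asymp
  have lower: "d 0 - e 0 \<le> d i" for i
  proof -
    have "d 0 - e 0 \<le> d i - e i"
      using inc by (simp add: incseq_def)
    moreover have "e i \<ge> 0"
      by (simp add: e_def)
    ultimately show ?thesis by linarith
  qed
  obtain L where L: "d \<longlonglongrightarrow> L" and "\<forall>i. L \<le> d i"
    by (rule decseq_convergent[OF dec, of "d 0 - e 0"]) (use lower in auto)
  then have L_le: "L \<le> d i" for i
    by simp
  have "(\<lambda>n. d n - e n) \<longlonglongrightarrow> L - 0"
    by (intro tendsto_diff L e0)
  then have le_L: "d i - e i \<le> L" for i
    using incseq_le[OF inc] by simp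
  have ratio: "stirling_ratio (Suc i) = exp (d i)" for i
    by (simp add: d_def stirling_ratio_pos)
  have s: "(\<lambda>i. stirling_ratio (Suc i)) \<longlonglongrightarrow> exp L"
    unfolding ratio by (intro tendsto_exp L)
  have "strict_mono (\<lambda>i. Suc (2 * i))"
    by (auto simp: strict_mono_def)
  from LIMSEQ_subseq_LIMSEQ[OF s this] have s2: "(\<lambda>i. stirling_ratio (2 * Suc i)) \<longlonglongrightarrow> exp L"
    by (simp add: o_def)
  have lim4: "(\<lambda>i. real (Suc i) / (2 * (2 * real (Suc i) + 1))) \<longlonglongrightarrow> 1 / 4"
    by real_asymp
  have "(\<lambda>i. (stirling_ratio (Suc i) ^ 2 / stirling_ratio (2 * Suc i)) ^ 2 *
      (real (Suc i) / (2 * (2 * real (Suc i) + 1)))) \<longlonglongrightarrow> (exp L ^ 2 / exp L) ^ 2 * (1 / 4)"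
    by (rule tendsto_mult[OF tendsto_power[OF tendsto_divide[OF tendsto_power[OF s] s2]] lim4]) simp
  moreover have "(\<lambda>i. (stirling_ratio (Suc i) ^ 2 / stirling_ratio (2 * Suc i)) ^ 2 *
      (real (Suc i) / (2 * (2 * real (Suc i) + 1)))) \<longlonglongrightarrow> pi / 2"
    using LIMSEQ_Suc[OF wallis] by (simp only: wallis_stirling_ratio zero_less_Suc)
  ultimately have "(exp L ^ 2 / exp L) ^ 2 * (1 / 4) = pi / 2"
    by (rule LIMSEQ_unique)
  then have "exp L ^ 2 = 2 * pi"
    by (simp add: power2_eq_square)
  then have exp_L: "exp L = sqrt (2 * pi)"
    using real_sqrt_unique[of "exp L" "2 * pi"] by simp
  obtain i where n: "n = Suc i"
    using assms by (cases n) auto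
  show "sqrt (2 * pi) \<le> stirling_ratio n"
    using L_le[of i] unfolding n ratio exp_L[symmetric] by simp
  have "exp (d i) \<le> exp (L + e i)"
    using le_L[of i] by simp
  then show "stirling_ratio n \<le> sqrt (2 * pi) * exp (1 / (4 * real n))"
    by (simp only: n ratio exp_add exp_L e_def)
qed

text \<open>
  The error consists of at most \<open>4\<close> from \<open>ramanujan_Q_exp_bounds\<close> and at most \<open>3 / 2\<close> from Stirling's formula.
\<close>

lemma ramanujan_Q_asymp:
  assumes "n > 0"
  shows "\<bar>2 * ramanujan_Q n - sqrt (2 * pi) * sqrt (real n)\<bar> \<le> 4"
proof -
  define x where "x = real n"
  have x: "x \<ge> 1"
    using assms by (simp add: x_def)
  have eq: "fact n * exp (real n) / real n ^ n = stirling_ratio n * sqrt x"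
    using x by (simp add: stirling_ratio_def x_def)
  have "exp (1 / (4 * x)) \<le> 1 + 2 * (1 / (4 * x))"
  proof -
    have "norm (1 / (4 * x)) \<le> 1 / 2"
      using x by (simp add: divide_simps)
    from exp_bound_lemma[OF this] show ?thesis
      using x by simp
  qed
  then have "sqrt (2 * pi) * exp (1 / (4 * x)) \<le> sqrt (2 * pi) * (1 + 1 / (2 * x))"
    by (intro mult_left_mono) auto
  with stirling_ratio_bounds(2)[OF assms] have "stirling_ratio n \<le> sqrt (2 * pi) * (1 + 1 / (2 * x))"
    unfolding x_def by (rule order_trans)
  then have "stirling_ratio n * sqrt x \<le> sqrt (2 * pi) * (1 + 1 / (2 * x)) * sqrt x"
    by (rule mult_right_mono) (use x in simp)
  also have "\<dots> = sqrt (2 * pi) * sqrt x + sqrt (2 * pi) * (sqrt x / x) / 2"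
    by (simp only: distrib_left distrib_right mult_1_right) simp
  also have "sqrt (2 * pi) * (sqrt x / x) / 2 \<le> 3 * 1 / 2"
  proof (intro divide_right_mono mult_mono)
    show "sqrt (2 * pi) \<le> 3"
      using pi_less_4 by (intro real_le_lsqrt) auto
    have "sqrt x \<le> x"
      using x by (intro real_le_lsqrt) (auto simp: power2_eq_square)
    then show "sqrt x / x \<le> 1"
      using x by simp
  qed (use x in auto)
  finally have upper: "stirling_ratio n * sqrt x \<le> sqrt (2 * pi) * sqrt x + 3 * 1 / 2"
    by simp
  have lower: "sqrt (2 * pi) * sqrt x \<le> stirling_ratio n * sqrt x"
    by (rule mult_right_mono[OF stirling_ratio_bounds(1)[OF assms]]) (use x in simp)
  show ?thesis
    using ramanujan_Q_exp_bounds[OF assms, unfolded eq] upper lower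
    unfolding x_def[symmetric] by (intro abs_leI) linarith+
qed

section \<open>Fifth factorial moment: closed form and growth\<close>

text \<open>
  With \<open>N = n + 1\<close> the expected area is \<open>N * (2 * Q(N)) / 4 - N + 1 / 2\<close>, and the error term of
  \<open>2 * Q(N)\<close> is bounded; replacing \<open>N\<close> by \<open>n\<close> costs only \<open>O(sqrt n)\<close>.
\<close>

lemma expected_area_asymptotics:
  "(\<lambda>n. expected_area n - sqrt (2 * pi) / 4 * real n powr (3 / 2)) \<in> O(\<lambda>n. real n)"
proof -
  let ?c = "sqrt (2 * pi) / 4"
  have "\<bar>expected_area n - ?c * (real (Suc n) * sqrt (real (Suc n)))\<bar> \<le> 4 * \<bar>real n\<bar>" if "n \<ge> 1" for n
  proof -
    define N where "N = real (Suc n)"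
    define q where "q = 2 * ramanujan_Q (Suc n) - sqrt (2 * pi) * sqrt N"
    have "\<bar>q\<bar> \<le> 4"
      using ramanujan_Q_asymp[of "Suc n"] by (simp add: q_def N_def)
    then have "\<bar>N * q\<bar> \<le> N * 4"
      using mult_left_mono[of "\<bar>q\<bar>" 4 N] by (simp add: abs_mult N_def)
    moreover have "expected_area n - ?c * (N * sqrt N) = N * q / 4 - N + 1 / 2"
      unfolding expected_area_ramanujan_Q N_def[symmetric] q_def by (simp add: field_simps)
    moreover have "N \<le> 2 * real n" "N \<ge> 1"
      using that by (simp_all add: N_def)
    ultimately show ?thesis
      unfolding N_def[symmetric] by linarith
  qed
  then have "(\<lambda>n. expected_area n - ?c * (real (Suc n) * sqrt (real (Suc n)))) \<in> O(\<lambda>n. real n)"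
    by (intro bigoI[of _ 4] eventually_sequentiallyI[of 1]) simp
  moreover have "(\<lambda>n. real (Suc n) * sqrt (real (Suc n)) - real n powr (3 / 2)) \<in> O(\<lambda>n. real n)"
    by real_asymp
  then have "(\<lambda>n. ?c * (real (Suc n) * sqrt (real (Suc n)) - real n powr (3 / 2))) \<in> O(\<lambda>n. real n)"
    by simp
  ultimately have "(\<lambda>n. (expected_area n - ?c * (real (Suc n) * sqrt (real (Suc n)))) +
      ?c * (real (Suc n) * sqrt (real (Suc n)) - real n powr (3 / 2))) \<in> O(\<lambda>n. real n)"
    by (rule sum_in_bigo)
  then show ?thesis
    by (simp add: algebra_simps)
qed

lemma fifth_moment_closed_form:
  "area_factorial_moment 5 n =
     horner_sum id (real n) fifth_coeffs_0 + horner_sum id (real n) fifth_coeffs_1 * expected_area n"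
  using binomial_moment_5[of n] binomial_moment_0_pos[of n]
  by (simp add: area_factorial_moment_eq expected_area_eq fact_numeral add_divide_distrib)

text \<open>
  Only the leading coefficient of the multiplier reaches the main term, and
  \<open>565 / 2048 * sqrt (2 * pi) / 4 = 565 / 8192 * sqrt (2 * pi)\<close>. All else is \<open>O(n ^ 7)\<close>: the free
  part has degree 7, the \<open>O(n)\<close> error of the expected area meets a polynomial of degree 6, and the lower
  terms of the multiplier give \<open>n powr (13 / 2)\<close>.
\<close>

lemma fifth_moment_asymptotics:
  "(\<lambda>n. area_factorial_moment 5 n - (565 / 8192) * sqrt (2 * pi) * real n powr (15 / 2)) \<in> O(\<lambda>n. real n ^ 7)"
proof -
  define E where "E = (\<lambda>n. expected_area n - sqrt (2 * pi) / 4 * real n powr (3 / 2))"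
  define p where "p = (\<lambda>n. horner_sum id (real n) fifth_coeffs_0)"
  define r where "r = (\<lambda>n. horner_sum id (real n) fifth_coeffs_1)"
  have E: "E \<in> O(\<lambda>n. real n)"
    unfolding E_def by (rule expected_area_asymptotics)
  have p: "p \<in> O(\<lambda>n. real n ^ 7)"
    unfolding p_def fifth_coeffs_0_def horner_sum_simps id_apply by real_asymp
  have r6: "r \<in> O(\<lambda>n. real n ^ 6)"
    unfolding r_def fifth_coeffs_1_def horner_sum_simps id_apply by real_asymp
  have r: "(\<lambda>n. (r n - 565 / 2048 * real n ^ 6) * real n powr (3 / 2)) \<in> O(\<lambda>n. real n ^ 7)"
    unfolding r_def fifth_coeffs_1_def horner_sum_simps id_apply by real_asymp
  have "(\<lambda>n. r n * E n) \<in> O(\<lambda>n. real n ^ 6 * real n)"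
    by (rule landau_o.big.mult[OF r6 E])
  then have rE: "(\<lambda>n. r n * E n) \<in> O(\<lambda>n. real n ^ 7)"
    by (simp flip: power_Suc2)
  have "area_factorial_moment 5 n - (565 / 8192) * sqrt (2 * pi) * real n powr (15 / 2) =
      p n + (r n * E n + sqrt (2 * pi) / 4 * ((r n - 565 / 2048 * real n ^ 6) * real n powr (3 / 2)))" for n
  proof -
    have "real n powr (15 / 2) = real n powr (6 + 3 / 2)"
      by simp
    also have "\<dots> = real n powr 6 * real n powr (3 / 2)"
      by (rule powr_add)
    also have "real n powr 6 = real n ^ 6"
      by (cases "n = 0") simp_all
    finally have powr: "real n powr (15 / 2) = real n ^ 6 * real n powr (3 / 2)" .
    have moment: "area_factorial_moment 5 n = p n + r n * expected_area n"
      by (simp only: fifth_moment_closed_form p_def r_def)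
    show ?thesis
      unfolding powr moment E_def by (simp add: algebra_simps)
  qed
  moreover have "(\<lambda>n. p n + (r n * E n + sqrt (2 * pi) / 4 * ((r n - 565 / 2048 * real n ^ 6) * real n powr (3 / 2))))
      \<in> O(\<lambda>n. real n ^ 7)"
    by (intro sum_in_bigo p rE landau_o.big.cmult_in_iff[THEN iffD2] r) simp
  ultimately show ?thesis
    by simp
qed

theorem theorem2p11:
  shows "(\<forall>n::nat. n \<ge> 1 \<longrightarrow>
      area_factorial_moment 5 n =
        - (105845 / 110592) * real n ^ 7 - (2170159 / 290304) * real n ^ 6
        - (99955651 / 3870720) * real n ^ 5 - (30773609 / 725760) * real n ^ 4
        - (94846903 / 11612160) * real n ^ 3 + (24676991 / 483840) * real n ^ 2
        + (392763901 / 11612160) * real n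
        + ((565 / 2048) * real n ^ 6 + (1005 / 128) * real n ^ 5
           + (9832585 / 165888) * real n ^ 4 + (1111349 / 5184) * real n ^ 3
           + (826358527 / 1935360) * real n ^ 2 + (159943787 / 362880) * real n
           + 1024580441 / 5806080) * expected_area n)
    \<and> (\<lambda>n::nat. area_factorial_moment 5 n - (565 / 8192) * sqrt (2 * pi) * real n powr (15 / 2))
        \<in> O(\<lambda>n. real n ^ 7)"
proof (intro conjI allI impI fifth_moment_asymptotics)
  fix n :: nat
  show "area_factorial_moment 5 n =
        - (105845 / 110592) * real n ^ 7 - (2170159 / 290304) * real n ^ 6
        - (99955651 / 3870720) * real n ^ 5 - (30773609 / 725760) * real n ^ 4
        - (94846903 / 11612160) * real n ^ 3 + (24676991 / 483840) * real n ^ 2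
        + (392763901 / 11612160) * real n
        + ((565 / 2048) * real n ^ 6 + (1005 / 128) * real n ^ 5
           + (9832585 / 165888) * real n ^ 4 + (1111349 / 5184) * real n ^ 3
           + (826358527 / 1935360) * real n ^ 2 + (159943787 / 362880) * real n
           + 1024580441 / 5806080) * expected_area n"
    by (simp add: fifth_moment_closed_form fifth_coeffs_0_def fifth_coeffs_1_def
        power_numeral_reduce algebra_simps)
qed

end
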